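(* The weight distribution of quasi-quadratic residue codes is asymptotically normal. That is, for primes $p\equiv3\pmod4$ let $C_p$ be the quasi-quadratic residue code associated with $p$ and $A^{(p)}(z)$ the cumulative distribution function of $C_p$; then, as $p\to\infty$ through primes $p\equiv 3\pmod 4$, $A^{(p)}(z)\to\Phi(z)$ for every real $z$, where $\Phi$ is the cumulative distribution function of the standard normal distribution.
   Context: For an odd prime $p$, let $Q\subset\mathbb{F}_p$ be the set of (nonzero) quadratic residues and $N$ the set of quadratic non-residues. For $S\subseteq\mathbb{F}_p$ put $r_S=\sum_{a\in S}x^a\in\mathbb{F}_2[x]/(x^p-1)$. The quasi-quadratic residue (QQR) code associated with $p$ is $C_p=\{(r_Qr_S,\,r_Nr_S):S\subseteq\mathbb{F}_p\}$, a binary linear code in $\mathbb{F}_2^{2p}$ via coefficient vectors. For a binary linear code $C$ of length $n$ and dimension $k$, with $A_j$ codewords of weight $j$, put $a_j=A_j/2^k$, mean $\mu=\sum_{j=0}^n ja_j$, variance $\sigma^2=\sum_{j=0}^n(\mu-j)^2a_j$; the cumulative distribution function of $C$ is $A(z)=\sum_{\mu-\sigma z\le j\le n}a_j$. *)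

theory Defs
  imports
    "HOL-Probability.Probability"
    "HOL-Number_Theory.Number_Theory"
    "HOL-Library.Z2"
    "Jordan_Normal_Form.VS_Connect"
begin

no_notation Finite_Cartesian_Product.vec_nth (infixl \<open>$\<close> 90)

definition hamming_weight :: "'a::zero Matrix.vec \<Rightarrow> nat" where
  "hamming_weight v = card {i. i < dim_vec v \<and> v $ i \<noteq> 0}"

text \<open>A binary linear code of length \<open>n\<close> is a subspace of \<open>module_vec TYPE(bit) n\<close>.\<close>

definition code_dim :: "nat \<Rightarrow> bit Matrix.vec set \<Rightarrow> nat" where
  "code_dim n C = vectorspace.dim class_ring (module_vec TYPE(bit) n\<lparr>carrier := C\<rparr>)"

definition weight_count :: "bit Matrix.vec set \<Rightarrow> nat \<Rightarrow> nat" where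
  "weight_count C j = card {c \<in> C. hamming_weight c = j}"

definition weight_freq :: "nat \<Rightarrow> bit Matrix.vec set \<Rightarrow> nat \<Rightarrow> real" where
  "weight_freq n C j = real (weight_count C j) / 2 ^ code_dim n C"

definition code_mean :: "nat \<Rightarrow> bit Matrix.vec set \<Rightarrow> real" where
  "code_mean n C = (\<Sum>j=0..n. real j * weight_freq n C j)"

definition code_variance :: "nat \<Rightarrow> bit Matrix.vec set \<Rightarrow> real" where
  "code_variance n C = (\<Sum>j=0..n. (code_mean n C - real j)\<^sup>2 * weight_freq n C j)"

text \<open>The sum runs over the \<^emph>\<open>upper\<close> range of weights, those at least \<open>\<mu> - \<sigma> z\<close>.\<close>

definition code_cdf :: "nat \<Rightarrow> bit Matrix.vec set \<Rightarrow> real \<Rightarrow> real" where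
  "code_cdf n C z =
     (\<Sum>j | j \<le> n \<and> code_mean n C - sqrt (code_variance n C) * z \<le> real j. weight_freq n C j)"

text \<open>
  The field of \<open>p\<close> elements is represented by \<open>{0..<p}\<close>, and elements of the ring of binary
  polynomials modulo \<open>x ^ p - 1\<close> by their remainders of degree less than \<open>p\<close>. Since \<open>QuadRes\<close>
  also holds of \<open>0\<close>, the residue \<open>0\<close> is left out explicitly.
\<close>

definition quad_residues :: "nat \<Rightarrow> nat set" where
  "quad_residues p = {a \<in> {0..<p}. a \<noteq> 0 \<and> QuadRes (int p) (int a)}"

definition quad_nonresidues :: "nat \<Rightarrow> nat set" where
  "quad_nonresidues p = {a \<in> {0..<p}. \<not> QuadRes (int p) (int a)}"

definition set_poly :: "nat set \<Rightarrow> bit poly" where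
  "set_poly S = (\<Sum>a\<in>S. Polynomial.monom 1 a)"

definition cyclic_mult :: "nat \<Rightarrow> bit poly \<Rightarrow> bit poly \<Rightarrow> bit poly" where
  "cyclic_mult p f g = (f * g) mod (Polynomial.monom 1 p - 1)"

definition coeff_vec :: "nat \<Rightarrow> bit poly \<Rightarrow> bit Matrix.vec" where
  "coeff_vec p f = Matrix.vec p (Polynomial.coeff f)"

definition qqr_code :: "nat \<Rightarrow> bit Matrix.vec set" where
  "qqr_code p =
     {coeff_vec p (cyclic_mult p (set_poly (quad_residues p)) (set_poly S)) @\<^sub>v
      coeff_vec p (cyclic_mult p (set_poly (quad_nonresidues p)) (set_poly S)) |S. S \<subseteq> {0..<p}}"

lemma set_poly_add:
  assumes "finite S" "finite T"
  shows "set_poly S + set_poly T = set_poly ((S - T) \<union> (T - S))"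
proof -
  have c: "Polynomial.coeff (set_poly A) i = of_bool (i \<in> A)" if "finite A" for A i
    using that by (simp add: set_poly_def coeff_sum sum.delta)
  show ?thesis
    using assms by (intro poly_eqI) (auto simp: c)
qed

lemma qqr_code_subspace:
  "VectorSpace.subspace class_ring (qqr_code p) (module_vec TYPE(bit) (2 * p))"
proof -
  interpret vec_space "TYPE(bit)" "2 * p" .
  let ?w = "\<lambda>S. coeff_vec p (cyclic_mult p (set_poly (quad_residues p)) (set_poly S)) @\<^sub>v
      coeff_vec p (cyclic_mult p (set_poly (quad_nonresidues p)) (set_poly S))"
  have sub: "qqr_code p \<subseteq> carrier_vec (2 * p)"
    by (auto simp: qqr_code_def coeff_vec_def mult_2)
  have zero: "?w {} = 0\<^sub>v (2 * p)"
    by (intro eq_vecI) (auto simp: coeff_vec_def cyclic_mult_def set_poly_def)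
  then have zero_in: "0\<^sub>v (2 * p) \<in> qqr_code p"
    unfolding qqr_code_def by (metis (mono_tags, lifting) empty_subsetI mem_Collect_eq)
  have add: "?w S + ?w T = ?w ((S - T) \<union> (T - S))" if "S \<subseteq> {0..<p}" "T \<subseteq> {0..<p}" for S T
  proof -
    have "finite S" "finite T"
      using that finite_subset by blast+
    then show ?thesis
      by (intro eq_vecI)
        (auto simp: coeff_vec_def cyclic_mult_def poly_mod_add_left distrib_left
          simp flip: set_poly_add)
  qed
  have add_in: "v + w \<in> qqr_code p" if v: "v \<in> qqr_code p" and w: "w \<in> qqr_code p" for v w
  proof -
    obtain S T where "S \<subseteq> {0..<p}" "v = ?w S" "T \<subseteq> {0..<p}" "w = ?w T"
      using v w unfolding qqr_code_def by blast
    moreover from this have "(S - T) \<union> (T - S) \<subseteq> {0..<p}" by blast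
    ultimately show ?thesis
      using add unfolding qqr_code_def by blast
  qed
  have smult_in: "c \<cdot>\<^sub>v v \<in> qqr_code p" if v: "v \<in> qqr_code p" for c v
  proof (cases c)
    case zero
    moreover have "0 \<cdot>\<^sub>v v = 0\<^sub>v (2 * p)"
      using v sub by (intro eq_vecI) auto
    ultimately show ?thesis using zero_in by simp
  next
    case one
    then show ?thesis using v by simp
  qed
  show ?thesis
    using sub zero_in add_in smult_in vec_vs[of "2 * p", where 'a = bit]
    unfolding VectorSpace.subspace_def submodule_def vectorspace_def
    by (auto simp: module_vec_simps)
qed

end

theory Submission
  imports Defs "HOL-Algebra.Algebraic_Closure_Type" "HOL-Real_Asymp.Real_Asymp"
begin

hide_const (open) Divisibility.prime Polynomials.degree
no_notation fps_nth (infixl \<open>$\<close> 75)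
no_notation Polynomials.var (\<open>X\<index>\<close>)

text \<open>
  If a binary code has no nonzero parity check of weight at most \<open>k\<close>, then the first \<open>k\<close> moments of
  its weight distribution are those of the uniform distribution on the cube. So the characteristic
  functions of the two normalised distributions differ by at most a Taylor remainder, which is small
  for large \<open>k\<close>, and Levy's theorem applies as soon as the dual distance tends to infinity.

  For the dual distance, let \<open>\<zeta>\<close> be a root of unity of order \<open>p\<close> in characteristic 2. For a parity
  check with support \<open>U\<close> in the first half and \<open>V\<close> in the second, the sums
  \<open>\<alpha> * (\<Sum>i\<in>U. x ^ i) + \<beta> * (\<Sum>i\<in>V. x ^ i)\<close> and \<open>\<beta> * (\<Sum>i\<in>U. x ^ i) + \<alpha> * (\<Sum>i\<in>V. x ^ i)\<close> vanish
  at \<open>\<zeta> ^ - k\<close> for all residues, respectively nonresidues \<open>k\<close>, where \<open>\<alpha>\<close> and \<open>\<beta>\<close> are the Gauss sums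
  over residues and nonresidues. By Dirichlet's simultaneous approximation, if \<open>U\<close> and \<open>V\<close> are small,
  some dilation \<open>i \<mapsto> q * i\<close> moves all exponents into an interval shorter than \<open>(p - 1) / 2\<close>; the
  resulting polynomial has more roots than its degree, so it is zero. Hence \<open>\<alpha> = \<beta> = 0\<close> or
  \<open>\<alpha> + \<beta> = 0\<close>, which contradicts \<open>\<alpha> + \<beta> = - 1\<close>.
\<close>

section \<open>Sparse sums over roots of unity\<close>

lemma power_mod_root_of_unity:
  fixes \<zeta> :: "'a::monoid_mult"
  assumes "\<zeta> ^ p = 1"
  shows "\<zeta> ^ (k mod p) = \<zeta> ^ k"
proof -
  have "\<zeta> ^ k = \<zeta> ^ (p * (k div p) + k mod p)"
    by simp
  also have "\<dots> = \<zeta> ^ (k mod p)"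
    by (simp only: power_add power_mult assms) simp
  finally show ?thesis ..
qed

text \<open>If two powers agree, then \<open>\<zeta> ^ (k - j) = 1\<close> with \<open>k - j\<close>
  invertible modulo the prime \<open>p\<close>; raising this to the inverse exponent forces
  \<open>\<zeta> = 1\<close>.\<close>

lemma root_of_unity_inj:
  fixes \<zeta> :: "'a::field"
  assumes "prime p" "\<zeta> ^ p = 1" "\<zeta> \<noteq> 1"
  shows "inj_on (\<lambda>k. \<zeta> ^ k) {..<p}"
proof -
  have nz: "\<zeta> \<noteq> 0"
    using assms prime_gt_0_nat by (metis power_0_left less_not_refl zero_neq_one)
  have aux: "j = k" if "j \<le> k" "k < p" "\<zeta> ^ j = \<zeta> ^ k" for j k
  proof (rule ccontr)
    assume "j \<noteq> k"
    with that have *: "0 < k - j" "k - j < p"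
      by auto
    have "\<zeta> ^ j * \<zeta> ^ (k - j) = \<zeta> ^ j * 1"
      using that by (metis le_add_diff_inverse mult.right_neutral power_add)
    then have one: "\<zeta> ^ (k - j) = 1"
      using nz by simp
    have "coprime (k - j) p"
      using * assms(1) by (metis coprime_commute nat_dvd_not_less prime_imp_coprime)
    then obtain x where x: "[(k - j) * x = 1] (mod p)"
      using cong_solve_coprime_nat by (metis One_nat_def)
    have "1 = (\<zeta> ^ (k - j)) ^ x"
      by (simp add: one)
    also have "\<dots> = \<zeta> ^ (((k - j) * x) mod p)"
      by (simp add: power_mod_root_of_unity[OF assms(2)] power_mult)
    also have "((k - j) * x) mod p = 1"
      using x prime_gt_1_nat[OF assms(1)] by (simp add: cong_def)
    finally show False
      using assms(3) by simp
  qed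
  show ?thesis
    by (rule inj_onI) (metis aux lessThan_iff nle_le)
qed

lemma mult_mod_prime_inj:
  fixes p q :: nat
  assumes "prime p" "\<not> p dvd q"
  shows "inj_on (\<lambda>k. q * k mod p) {..<p}"
proof (rule inj_onI)
  fix j k assume "j \<in> {..<p}" "k \<in> {..<p}" "q * j mod p = q * k mod p"
  moreover have "coprime q p"
    using assms by (meson coprime_commute prime_imp_coprime)
  ultimately show "j = k"
    by (metis cong_def cong_mult_lcancel_nat lessThan_iff mod_less)
qed

lemma mult_mod_prime_image:
  fixes p q :: nat
  assumes "prime p" "\<not> p dvd q"
  shows "(\<lambda>k. q * k mod p) ` {..<p} = {..<p}"
  using mult_mod_prime_inj[OF assms] prime_gt_0_nat[OF assms(1)]
  by (intro card_subset_eq) (auto simp: card_image)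

text \<open>Pigeonhole: cut the residues into five arcs of length \<open>p / 5\<close> and record
  for each \<open>q < p\<close> the arcs containing \<open>q * i mod p\<close> for \<open>i\<close>
  in \<open>M\<close>. There are at most \<open>5 ^ card M < p\<close> records, so two dilations
  share one. Two one-sided inequalities replace an absolute value on natural numbers.\<close>

lemma simultaneous_dilation:
  fixes p :: nat
  assumes "finite M" "5 ^ card M < p"
  obtains q1 q2 where "q1 < q2" "q2 < p"
    "\<And>i. i \<in> M \<Longrightarrow> q1 * i mod p \<le> q2 * i mod p + p div 5"
    "\<And>i. i \<in> M \<Longrightarrow> q2 * i mod p \<le> q1 * i mod p + p div 5"
proof -
  define b where "b q = restrict (\<lambda>i. 5 * (q * i mod p) div p) M" for q
  have "b ` {..<p} \<subseteq> M \<rightarrow>\<^sub>E {..<5}"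
    using assms(2) by (auto simp: b_def less_mult_imp_div_less)
  then have "card (b ` {..<p}) \<le> 5 ^ card M"
    using assms(1) card_mono[OF finite_PiE, of M "\<lambda>_. {..<5}"] by (force simp: card_PiE)
  then have "\<not> inj_on b {..<p}"
    using assms(2) by (intro pigeonhole) simp
  then obtain x y where "x < p" "y < p" "x \<noteq> y" "b x = b y"
    by (auto simp: inj_on_def)
  then obtain q1 q2 where q: "q1 < q2" "q2 < p" "b q1 = b q2"
    by (metis nat_neq_iff)
  \<comment> \<open>Numbers in the same arc differ by less than \<open>p / 5\<close>, so, being
    integers, by at most \<open>p div 5\<close>.\<close>
  have close: "u \<le> v + p div 5" if "5 * u div p = 5 * v div p" for u v :: nat
  proof -
    have p: "p > 0" using assms(2) by simp
    have "5 * u < p * (5 * v div p) + p"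
      using p that by (metis mult.commute dividend_less_div_times add.commute)
    moreover have "p * (5 * v div p) \<le> 5 * v"
      by (rule times_div_less_eq_dividend)
    ultimately have "5 * u < 5 * v + p" by (rule less_le_trans[OF _ add_right_mono])
    then show ?thesis by presburger
  qed
  have "5 * (q1 * i mod p) div p = 5 * (q2 * i mod p) div p" if "i \<in> M" for i
    using q(3) that by (simp add: b_def restrict_def fun_eq_iff) metis
  with q that close show thesis by metis
qed

text \<open>The dilation by \<open>q = q2 - q1\<close> brings all exponents within
  \<open>p div 5\<close> of a multiple of \<open>p\<close>. After a shift the polynomial has degree
  at most \<open>2 * (p div 5)\<close>, while the dilation only permutes the evaluation points, so
  there are still \<open>card R\<close> roots.\<close>

lemma sparse_polynomial_zeros:
  fixes \<zeta> :: "'a::field" and f :: "nat \<Rightarrow> 'a"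
  assumes p: "prime p" and \<zeta>: "\<zeta> ^ p = 1" "\<zeta> \<noteq> 1"
    and M: "M \<subseteq> {..<p}" "5 ^ card M < p"
    and R: "R \<subseteq> {..<p}" "2 * (p div 5) < card R"
    and zero: "\<And>k. k \<in> R \<Longrightarrow> (\<Sum>i\<in>M. f i * \<zeta> ^ (k * i)) = 0"
    and i: "i \<in> M"
  shows "f i = 0"
proof -
  have fin: "finite M" using M(1) finite_subset by blast
  have nz: "\<zeta> \<noteq> 0"
    using \<zeta>(1) prime_gt_0_nat[OF p] by (metis power_0_left less_not_refl zero_neq_one)
  obtain q1 q2 where q: "q1 < q2" "q2 < p"
    and le1: "\<And>i. i \<in> M \<Longrightarrow> q1 * i mod p \<le> q2 * i mod p + p div 5"
    and le2: "\<And>i. i \<in> M \<Longrightarrow> q2 * i mod p \<le> q1 * i mod p + p div 5"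
    using simultaneous_dilation[OF fin M(2)] by metis
  define q where "q = q2 - q1"
  have nd: "\<not> p dvd q"
    using q by (auto simp: q_def dest: dvd_imp_le)
  \<comment> \<open>The new exponent is congruent to \<open>q * i + p div 5\<close> modulo
    \<open>p\<close>; the shift by \<open>p div 5\<close> keeps it nonnegative.\<close>
  define e where "e i = q2 * i mod p + p div 5 - q1 * i mod p" for i
  have e: "e i + q1 * i mod p = q2 * i mod p + p div 5" if "i \<in> M" for i
    using le1[OF that] by (simp add: e_def)
  have e_le: "e i \<le> 2 * (p div 5)" if "i \<in> M" for i
    using le2[OF that] by (simp add: e_def)
  \<comment> \<open>The factor caused by the shift does not depend on \<open>i\<close>, so it can be
    pulled out of the whole sum.\<close>
  have pow_e: "\<zeta> ^ (k * e i) = \<zeta> ^ (k * (p div 5)) * \<zeta> ^ (q * k mod p * i)" if "i \<in> M" for i k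
  proof -
    have \<zeta>k: "(\<zeta> ^ k) ^ p = 1"
      using \<zeta>(1) by (metis mult.commute power_mult power_one)
    have "\<zeta> ^ (k * e i) * \<zeta> ^ (k * (q1 * i)) = (\<zeta> ^ k) ^ e i * (\<zeta> ^ k) ^ (q1 * i mod p)"
      by (simp add: power_mod_root_of_unity[OF \<zeta>k] power_mult)
    also have "\<dots> = (\<zeta> ^ k) ^ (q2 * i mod p) * (\<zeta> ^ k) ^ (p div 5)"
      by (simp add: e[OF that] flip: power_add)
    also have "(\<zeta> ^ k) ^ (q2 * i mod p) = (\<zeta> ^ k) ^ (q2 * i)"
      by (rule power_mod_root_of_unity[OF \<zeta>k])
    also have "\<dots> = \<zeta> ^ (k * (q1 * i)) * \<zeta> ^ (q * k * i)"
      using q(1) by (simp add: q_def algebra_simps flip: power_mult power_add)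
    also have "\<zeta> ^ (q * k * i) = (\<zeta> ^ (q * k)) ^ i"
      by (rule power_mult)
    also have "\<zeta> ^ (q * k) = \<zeta> ^ (q * k mod p)"
      using \<zeta>(1) by (rule power_mod_root_of_unity[symmetric])
    finally have eq: "\<zeta> ^ (k * e i) * \<zeta> ^ (k * (q1 * i))
        = \<zeta> ^ (k * (q1 * i)) * (\<zeta> ^ (q * k mod p)) ^ i * (\<zeta> ^ k) ^ (p div 5)" .
    have "x = u * v" if "x * w = w * v * u" "w \<noteq> 0" for x u v w :: 'a
      using that by (metis mult.commute mult.assoc mult_right_cancel)
    from this[OF eq] show ?thesis
      using nz by (simp only: power_mult[symmetric] power_not_zero not_False_eq_True simp_thms)
  qed
  \<comment> \<open>Distinct indices keep distinct exponents, so every \<open>f i\<close> survives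
    as a separate coefficient of \<open>P\<close>.\<close>
  have e_inj: "inj_on e M"
  proof (rule inj_onI)
    fix i j assume ij: "i \<in> M" "j \<in> M" "e i = e j"
    have "\<zeta> ^ (p div 5) * \<zeta> ^ (q * 1 mod p * i) = \<zeta> ^ (p div 5) * \<zeta> ^ (q * 1 mod p * j)"
      using pow_e[OF ij(1), of 1] pow_e[OF ij(2), of 1] ij(3) by (simp only: mult_1)
    then have "\<zeta> ^ (q mod p * i mod p) = \<zeta> ^ (q mod p * j mod p)"
      using nz by (simp add: power_mod_root_of_unity[OF \<zeta>(1)])
    then have "\<zeta> ^ (q * i mod p) = \<zeta> ^ (q * j mod p)"
      by (simp only: mod_mult_left_eq)
    moreover have "q * i mod p < p" "q * j mod p < p"
      using prime_gt_0_nat[OF p] by auto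
    ultimately have "q * i mod p = q * j mod p"
      using root_of_unity_inj[OF p \<zeta>] by (auto simp: inj_on_def)
    then show "i = j"
      using mult_mod_prime_inj[OF p nd] M(1) ij by (auto simp: inj_on_def)
  qed
  define P where "P = (\<Sum>i\<in>M. Polynomial.monom (f i) (e i))"
  have "degree P \<le> 2 * (p div 5)"
    unfolding P_def by (intro degree_sum_le fin) (metis degree_monom_le e_le le_trans)
  have root: "poly P (\<zeta> ^ k) = 0" if "q * k mod p \<in> R" for k
  proof -
    have "poly P (\<zeta> ^ k) = (\<Sum>i\<in>M. f i * \<zeta> ^ (k * e i))"
      by (simp add: P_def poly_sum poly_monom power_mult)
    also have "\<dots> = \<zeta> ^ (k * (p div 5)) * (\<Sum>i\<in>M. f i * \<zeta> ^ (q * k mod p * i))"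
      unfolding sum_distrib_left by (intro sum.cong refl) (metis pow_e mult.left_commute)
    also have "\<dots> = 0"
      by (simp only: zero[OF that] mult_zero_right)
    finally show ?thesis .
  qed
  have "P = 0"
  proof (rule ccontr)
    assume "P \<noteq> 0"
    \<comment> \<open>The preimage of \<open>R\<close> under the dilation has the same size as
      \<open>R\<close> and yields that many distinct roots \<open>\<zeta> ^ k\<close>.\<close>
    define R' where "R' = {k \<in> {..<p}. q * k mod p \<in> R}"
    have "(\<lambda>k. q * k mod p) ` R' = R"
    proof (intro subset_antisym subsetI)
      fix b assume "b \<in> R"
      moreover from this obtain k where "k < p" "b = q * k mod p"
        using mult_mod_prime_image[OF p nd] R(1) by auto
      ultimately show "b \<in> (\<lambda>k. q * k mod p) ` R'"
        by (auto simp: R'_def)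
    qed (auto simp: R'_def)
    moreover have "R' \<subseteq> {..<p}"
      by (auto simp: R'_def)
    ultimately have "card R' = card R"
      using card_image[OF inj_on_subset[OF mult_mod_prime_inj[OF p nd]], of R'] by simp
    also have "card R' = card ((\<lambda>k. \<zeta> ^ k) ` R')"
      using inj_on_subset[OF root_of_unity_inj[OF p \<zeta>], of R']
      by (intro card_image[symmetric]) (auto simp: R'_def)
    finally have "card R = card ((\<lambda>k. \<zeta> ^ k) ` R')" by simp
    also have "\<dots> \<le> card {x. poly P x = 0}"
      using \<open>P \<noteq> 0\<close> root by (intro card_mono poly_roots_finite) (auto simp: R'_def)
    also have "\<dots> \<le> degree P"
      using \<open>P \<noteq> 0\<close> by (rule card_poly_roots_bound)
    finally show False
      using \<open>degree P \<le> 2 * (p div 5)\<close> R(2) by simp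
  qed
  then have "0 = Polynomial.coeff P (e i)" by simp
  also have "\<dots> = (\<Sum>j\<in>M. if e j = e i then f j else 0)"
    by (simp add: P_def coeff_sum)
  also have "\<dots> = (\<Sum>j\<in>M. if j = i then f j else 0)"
    using e_inj i by (intro sum.cong) (auto simp: inj_on_def)
  also have "\<dots> = f i"
    using i fin by simp
  finally show ?thesis ..
qed

section \<open>Quadratic residues and cyclic products\<close>

lemma Legendre_values: "Legendre a p \<in> {-1, 0, 1}"
  by (simp add: Legendre_def)

lemma Legendre_cong: "[a = b] (mod p) \<Longrightarrow> Legendre a p = Legendre b p"
  by (simp add: Legendre_def QuadRes_def cong_def)

text \<open>Euler's criterion gives the congruence modulo \<open>p\<close>. Both sides lie in {-1,
  0, 1}, so they differ by at most 2, which is less than \<open>p\<close>.\<close>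

lemma Legendre_mult:
  fixes p :: nat
  assumes "prime p" "2 < p"
  shows "Legendre (a * b) p = Legendre a p * Legendre b p"
proof -
  let ?e = "(p - 1) div 2"
  have "[Legendre (a * b) p = a ^ ?e * b ^ ?e] (mod p)"
    using euler_criterion[OF assms, of "a * b"] by (simp add: power_mult_distrib)
  moreover have "[Legendre a p * Legendre b p = a ^ ?e * b ^ ?e] (mod p)"
    by (intro cong_mult euler_criterion assms)
  ultimately have "int p dvd Legendre (a * b) p - Legendre a p * Legendre b p"
    by (metis cong_iff_dvd_diff cong_sym cong_trans)
  moreover have "\<bar>Legendre (a * b) p - Legendre a p * Legendre b p\<bar> < int p"
    using Legendre_values[of "a * b" p] Legendre_values[of a p] Legendre_values[of b p] assms(2)
    by auto
  ultimately show ?thesis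
    using dvd_imp_le_int[of "Legendre (a * b) p - Legendre a p * Legendre b p" p]
    by (cases "Legendre (a * b) p - Legendre a p * Legendre b p = 0") auto
qed

lemma Legendre_mult_mod_nat:
  fixes p k a :: nat
  assumes "prime p" "2 < p"
  shows "Legendre (int (k * a mod p)) p = Legendre k p * Legendre a p"
  using Legendre_mult[OF assms, of k a] Legendre_cong[of "int (k * a mod p)" "int k * int a" p]
  by (simp add: zmod_int)

lemma Legendre_eq_0_iff:
  fixes p k :: nat
  shows "Legendre k p = 0 \<longleftrightarrow> p dvd k"
  by (auto simp: Legendre_def cong_0_iff)

lemma quad_residues_eq_Legendre: "quad_residues p = {a \<in> {..<p}. Legendre a p = 1}"
  by (auto simp: quad_residues_def Legendre_def cong_0_iff dest: dvd_imp_le intro!: Nat.gr0I)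

lemma quad_nonresidues_eq_Legendre:
  assumes "0 < p"
  shows "quad_nonresidues p = {a \<in> {..<p}. Legendre a p = - 1}"
proof -
  have "QuadRes p 0"
    unfolding QuadRes_def by (rule exI[of _ 0]) simp
  then show ?thesis
    using Legendre_cong[of _ 0 p]
    by (auto simp: quad_nonresidues_def Legendre_def cong_0_iff dest: dvd_imp_le)
qed

text \<open>Multiplication by \<open>k\<close> permutes the residues modulo \<open>p\<close> and
  multiplies Legendre symbols by that of \<open>k\<close>: a residue preserves the two classes, a
  nonresidue exchanges them.\<close>

lemma Legendre_class_image:
  fixes p k :: nat
  assumes "prime p" "2 < p" "\<not> p dvd k"
  shows "(\<lambda>a. k * a mod p) ` {a \<in> {..<p}. Legendre a p = c}
    = {a \<in> {..<p}. Legendre a p = Legendre k p * c}"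
proof (intro subset_antisym subsetI)
  fix b assume "b \<in> (\<lambda>a. k * a mod p) ` {a \<in> {..<p}. Legendre a p = c}"
  then obtain a where "Legendre a p = c" "b = k * a mod p"
    by blast
  then show "b \<in> {a \<in> {..<p}. Legendre a p = Legendre k p * c}"
    using assms(2) Legendre_mult_mod_nat[OF assms(1,2), of k a] by simp
next
  fix b assume b: "b \<in> {a \<in> {..<p}. Legendre a p = Legendre k p * c}"
  then obtain a where a: "a < p" "b = k * a mod p"
    using mult_mod_prime_image[OF assms(1,3)] by auto
  have "Legendre k p * Legendre a p = Legendre k p * c"
    using b a Legendre_mult_mod_nat[OF assms(1,2), of k a] by simp
  then have "Legendre a p = c"
    using assms(3) by (simp add: Legendre_eq_0_iff)
  with a show "b \<in> (\<lambda>a. k * a mod p) ` {a \<in> {..<p}. Legendre a p = c}"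
    by blast
qed

text \<open>Replacing \<open>\<zeta>\<close> by \<open>\<zeta> ^ k\<close> in a Gauss sum only
  permutes its exponents, so the result depends on \<open>k\<close> through its Legendre symbol
  alone.\<close>

lemma sum_Legendre_class:
  fixes p k :: nat and \<zeta> :: "'a::comm_semiring_1"
  assumes "prime p" "2 < p" "\<not> p dvd k" "\<zeta> ^ p = 1"
  shows "(\<Sum>a | a < p \<and> Legendre a p = c. \<zeta> ^ (k * a))
    = (\<Sum>a | a < p \<and> Legendre a p = Legendre k p * c. \<zeta> ^ a)"
proof -
  have "(\<Sum>a \<in> (\<lambda>a. k * a mod p) ` {a \<in> {..<p}. Legendre a p = c}. \<zeta> ^ a)
      = (\<Sum>a | a < p \<and> Legendre a p = c. \<zeta> ^ (k * a mod p))"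
    using inj_on_subset[OF mult_mod_prime_inj[OF assms(1,3)], of "{a \<in> {..<p}. Legendre a p = c}"]
    by (subst sum.reindex) auto
  also have "\<dots> = (\<Sum>a | a < p \<and> Legendre a p = c. \<zeta> ^ (k * a))"
    by (simp only: power_mod_root_of_unity[OF assms(4)])
  finally show ?thesis
    unfolding Legendre_class_image[OF assms(1-3)] by simp
qed

text \<open>Squaring modulo \<open>p\<close> identifies 1 and \<open>p - 1\<close>, so on a finite
  set it is not surjective; a value that it misses is a nonresidue.\<close>

lemma exists_quad_nonresidue:
  fixes p :: nat
  assumes "prime p" "2 < p"
  obtains k where "k < p" "Legendre k p = - 1"
proof -
  let ?sq = "\<lambda>x. x * x mod p"
  obtain m where "p = m + 2"
    using assms(2) by (metis add.commute less_imp_add_positive)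
  then have "(p - 1) * (p - 1) = 1 + m * p"
    by (simp add: algebra_simps)
  then have "?sq (p - 1) = ?sq 1"
    by (simp only: mod_mult_self1 mult_1)
  moreover have "p - 1 \<in> {..<p}" "1 \<in> {..<p}" "p - 1 \<noteq> 1"
    using assms(2) by auto
  ultimately have "\<not> inj_on ?sq {..<p}"
    unfolding inj_on_def by blast
  then have "?sq ` {..<p} \<noteq> {..<p}"
    using eq_card_imp_inj_on[of "{..<p}" ?sq] by auto
  moreover have "?sq ` {..<p} \<subseteq> {..<p}"
    using assms(2) by auto
  ultimately obtain k where k: "k < p" "k \<notin> ?sq ` {..<p}"
    by blast
  have "\<not> QuadRes p k"
  proof
    assume "QuadRes p k"
    then obtain y where y: "[y\<^sup>2 = int k] (mod p)"
      by (auto simp: QuadRes_def)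
    define x where "x = nat (y mod p)"
    have x: "int x = y mod p" "x < p"
      using assms(2) by (auto simp: x_def nat_less_iff)
    have "int (x * x mod p) = y * y mod p"
      by (simp add: zmod_int x mod_mult_eq)
    also have "\<dots> = int k"
      using y k(1) by (simp add: cong_def power2_eq_square)
    finally show False
      using k(2) x(2) by auto
  qed
  moreover have "k \<noteq> 0"
  proof
    assume "k = 0"
    moreover have "?sq 0 \<in> ?sq ` {..<p}"
      using assms(2) by (intro imageI) simp
    ultimately show False
      using k(2) by simp
  qed
  ultimately have "Legendre k p = -1"
    using k(1) by (auto simp: Legendre_def cong_0_iff dest: dvd_imp_le)
  with k(1) show thesis
    by (rule that)
qed

lemma quad_residues_Un_nonresidues:
  assumes "0 < p"
  shows "quad_residues p \<union> quad_nonresidues p = {1..<p}"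
  using assms
  by (auto simp: quad_residues_eq_Legendre quad_nonresidues_eq_Legendre Legendre_def cong_0_iff
      dest: dvd_imp_le intro!: Suc_leI Nat.gr0I)

text \<open>Multiplication by a nonresidue maps residues bijectively onto nonresidues, and the two
  classes partition the \<open>p - 1\<close> nonzero elements.\<close>

lemma card_quad_residues:
  assumes "prime p" "2 < p"
  shows "card (quad_residues p) = (p - 1) div 2" "card (quad_nonresidues p) = (p - 1) div 2"
proof -
  obtain k where k: "k < p" "Legendre k p = - 1"
    using exists_quad_nonresidue[OF assms] .
  then have nd: "\<not> p dvd k"
    using Legendre_eq_0_iff[of k p] by simp
  have "(\<lambda>a. k * a mod p) ` quad_residues p = quad_nonresidues p"
    using Legendre_class_image[OF assms nd, of 1] assms(2)
    by (simp add: k(2) quad_residues_eq_Legendre quad_nonresidues_eq_Legendre)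
  then have eq: "card (quad_residues p) = card (quad_nonresidues p)"
    using inj_on_subset[OF mult_mod_prime_inj[OF assms(1) nd], of "quad_residues p"]
    by (metis (no_types, lifting) card_image quad_residues_eq_Legendre mem_Collect_eq subsetI)
  have "quad_residues p \<union> quad_nonresidues p = {1..<p}"
    using assms(2) by (intro quad_residues_Un_nonresidues) simp
  moreover have "quad_residues p \<inter> quad_nonresidues p = {}"
    by (auto simp: quad_residues_def quad_nonresidues_def)
  moreover have "finite (quad_residues p)" "finite (quad_nonresidues p)"
    by (auto simp: quad_residues_def quad_nonresidues_def)
  ultimately have "card (quad_residues p) + card (quad_nonresidues p) = p - 1"
    by (metis card_Un_disjoint card_atLeastLessThan)
  with eq show "card (quad_residues p) = (p - 1) div 2" "card (quad_nonresidues p) = (p - 1) div 2"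
    by auto
qed

section \<open>Roots of unity and cyclic products of polynomials\<close>

text \<open>Take a root of \<open>1 + x + ... + x ^ (p - 1)\<close>. It is not 1, because the value
  at 1 is \<open>p\<close>, which is nonzero in the field.\<close>

lemma exists_root_of_unity:
  fixes p :: nat
  assumes "1 < p" "of_nat p \<noteq> (0 :: 'a::alg_closed_field)"
  obtains \<zeta> :: "'a::alg_closed_field" where "\<zeta> ^ p = 1" "\<zeta> \<noteq> 1"
proof -
  let ?P = "\<Sum>i<p. Polynomial.monom (1::'a) i"
  have "Polynomial.coeff ?P (p - 1) = 1"
    using assms(1) by (simp add: coeff_sum)
  then have "0 < degree ?P"
    using assms(1) by (metis le_degree less_le_trans zero_less_diff zero_neq_one)
  then obtain \<zeta> where "poly ?P \<zeta> = 0"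
    using alg_closed_imp_poly_has_root by blast
  then have sum: "(\<Sum>i<p. \<zeta> ^ i) = 0"
    by (simp add: poly_sum poly_monom)
  then have "\<zeta> \<noteq> 1"
    using assms(2) by auto
  moreover have "\<zeta> ^ p = 1"
    using sum power_diff_1_eq[of \<zeta> p] by simp
  ultimately show thesis
    by (rule that[rotated])
qed

lemma poly_mod_sum:
  fixes y :: "'a::field poly"
  shows "(\<Sum>a\<in>A. f a) mod y = (\<Sum>a\<in>A. f a mod y)"
  by (induction A rule: infinite_finite_induct) (simp_all add: poly_mod_add_left)

text \<open>The range \<open>k < 2 * p\<close> covers products of two reduced monomials; there, a
  single subtraction of \<open>p\<close> from the exponent completes the reduction.\<close>

lemma monom_mod_cyclic:
  assumes "k < 2 * p"
  shows "Polynomial.monom (1::'a::field) k mod (Polynomial.monom 1 p - 1) = Polynomial.monom 1 (k mod p)"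
proof -
  have p: "p > 0" using assms by (cases p) auto
  have deg: "degree (Polynomial.monom (1::'a) p - 1) = p"
    using p degree_add_eq_left[of "- 1 :: 'a poly" "Polynomial.monom 1 p"]
    by (simp add: degree_monom_eq)
  show ?thesis
  proof (cases "k < p")
    case True
    then show ?thesis
      by (simp add: mod_poly_less degree_monom_eq deg)
  next
    case False
    then have "Polynomial.monom (1::'a) k
        = Polynomial.monom 1 (k - p) + Polynomial.monom 1 (k - p) * (Polynomial.monom 1 p - 1)"
      by (simp add: algebra_simps mult_monom)
    also have "\<dots> mod (Polynomial.monom 1 p - 1) = Polynomial.monom 1 (k - p)"
      using False assms by (simp add: mod_poly_less degree_monom_eq deg)
    also have "k - p = k mod p"
      using False assms by (simp add: le_mod_geq)
    finally show ?thesis .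
  qed
qed

lemma add_mod_eq_iff:
  fixes p :: nat
  assumes "a < p" "s < p" "i < p"
  shows "(a + s) mod p = i \<longleftrightarrow> a = (i + (p - s)) mod p"
proof
  assume "(a + s) mod p = i"
  then have "(i + (p - s)) mod p = (a + s + (p - s)) mod p"
    by (metis mod_add_left_eq)
  also have "a + s + (p - s) = a + p"
    using assms by simp
  finally show "a = (i + (p - s)) mod p"
    using assms by simp
next
  assume "a = (i + (p - s)) mod p"
  then have "(a + s) mod p = (i + (p - s) + s) mod p"
    by (metis mod_add_left_eq)
  also have "i + (p - s) + s = i + p"
    using assms by simp
  finally show "(a + s) mod p = i"
    using assms by simp
qed

text \<open>Multiplication by \<open>x ^ s\<close> is a cyclic shift; \<open>i + (p - s)\<close> is
  \<open>i - s\<close> modulo \<open>p\<close>, written without negative numbers.\<close>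

lemma coeff_cyclic_mult_singleton:
  assumes A: "A \<subseteq> {..<p}" and "s < p" "i < p"
  shows "Polynomial.coeff (cyclic_mult p (set_poly A) (set_poly {s})) i
    = of_bool ((i + (p - s)) mod p \<in> A)"
proof -
  have fin: "finite A"
    using A finite_subset by blast
  have "cyclic_mult p (set_poly A) (set_poly {s})
      = (\<Sum>a\<in>A. Polynomial.monom 1 (a + s)) mod (Polynomial.monom 1 p - 1)"
    by (simp add: cyclic_mult_def set_poly_def sum_distrib_right mult_monom)
  also have "\<dots> = (\<Sum>a\<in>A. Polynomial.monom 1 ((a + s) mod p))"
    unfolding poly_mod_sum using A assms(2) by (intro sum.cong refl monom_mod_cyclic) auto
  also have "Polynomial.coeff \<dots> i = (\<Sum>a\<in>A. if (a + s) mod p = i then 1 else 0)"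
    by (simp add: coeff_sum)
  also have "\<dots> = (\<Sum>a\<in>A. if a = (i + (p - s)) mod p then 1 else 0)"
    using A assms(2,3) by (intro sum.cong refl if_cong add_mod_eq_iff) auto
  also have "\<dots> = of_bool ((i + (p - s)) mod p \<in> A)"
    using fin by simp
  finally show ?thesis .
qed

section \<open>The dual distance of the code\<close>

text \<open>Substituting \<open>a = i - s\<close> modulo \<open>p\<close> turns
  \<open>\<omega> ^ s\<close> into \<open>\<omega> ^ i * \<eta> ^ a\<close>: a Fourier transform
  over all shifts of \<open>A\<close> factors. Here \<open>\<eta>\<close> is the inverse of
  \<open>\<omega>\<close>.\<close>

lemma sum_shifted_indicator:
  fixes \<omega> \<eta> :: "'a::field"
  assumes \<omega>: "\<omega> ^ p = 1" "\<omega> * \<eta> = 1" and A: "A \<subseteq> {..<p}" and i: "i < p"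
  shows "(\<Sum>s<p. \<omega> ^ s * of_bool ((i + (p - s)) mod p \<in> A)) = \<omega> ^ i * (\<Sum>a\<in>A. \<eta> ^ a)"
proof -
  have fin: "finite A"
    using A finite_subset by blast
  have pow: "\<omega> ^ ((i + (p - a)) mod p) = \<omega> ^ i * \<eta> ^ a" if "a < p" for a
  proof -
    have "\<omega> ^ (p - a) * \<omega> ^ a = 1"
      using that \<omega>(1) by (simp flip: power_add)
    moreover have "\<omega> ^ a * \<eta> ^ a = 1"
      using \<omega>(2) by (simp flip: power_mult_distrib)
    ultimately have "\<omega> ^ (p - a) = \<eta> ^ a"
      by (metis mult.assoc mult.commute mult_1)
    then show ?thesis
      by (simp add: power_mod_root_of_unity[OF \<omega>(1)] power_add)
  qed
  have "(\<Sum>s<p. \<omega> ^ s * of_bool ((i + (p - s)) mod p \<in> A))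
      = (\<Sum>s<p. \<Sum>a\<in>A. if a = (i + (p - s)) mod p then \<omega> ^ s else 0)"
    using fin by (intro sum.cong) auto
  also have "\<dots> = (\<Sum>s<p. \<Sum>a\<in>A. if s = (i + (p - a)) mod p then \<omega> ^ s else 0)"
  proof (intro sum.cong refl)
    fix s a assume "s \<in> {..<p}" "a \<in> A"
    then have "a = (i + (p - s)) mod p \<longleftrightarrow> s = (i + (p - a)) mod p"
      using A i add_mod_eq_iff[of a p s i] add_mod_eq_iff[of s p a i] by (auto simp: add.commute)
    then show "(if a = (i + (p - s)) mod p then \<omega> ^ s else 0)
        = (if s = (i + (p - a)) mod p then \<omega> ^ s else 0)"
      by simp
  qed
  also have "\<dots> = (\<Sum>a\<in>A. \<Sum>s<p. if s = (i + (p - a)) mod p then \<omega> ^ s else 0)"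
    by (rule sum.swap)
  also have "\<dots> = (\<Sum>a\<in>A. \<omega> ^ i * \<eta> ^ a)"
    using i A by (intro sum.cong refl) (auto intro!: pow)
  finally show ?thesis
    by (simp add: sum_distrib_left)
qed

lemma sum_split_halves:
  fixes h :: "nat \<Rightarrow> 'a::comm_monoid_add"
  assumes "W \<subseteq> {..<2 * p}"
  shows "sum h W = (\<Sum>i | i < p \<and> i \<in> W. h i) + (\<Sum>j | j < p \<and> p + j \<in> W. h (p + j))"
    and "card W = card {i. i < p \<and> i \<in> W} + card {j. j < p \<and> p + j \<in> W}"
proof -
  have W: "W = {i. i < p \<and> i \<in> W} \<union> (+) p ` {j. j < p \<and> p + j \<in> W}" (is "_ = ?U \<union> ?V")
  proof (intro subset_antisym subsetI)
    fix i assume "i \<in> W"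
    moreover have "i = p + (i - p)" "i - p < p" if "\<not> i < p"
      using that assms \<open>i \<in> W\<close> by auto
    ultimately show "i \<in> ?U \<union> ?V"
      by (cases "i < p") (auto intro!: image_eqI[of i _ "i - p"])
  qed auto
  have disj: "?U \<inter> ?V = {}" by auto
  have "sum h W = sum h ?U + sum h ?V"
    by (subst (1) W, rule sum.union_disjoint) (use disj in auto)
  then show "sum h W = (\<Sum>i | i < p \<and> i \<in> W. h i) + (\<Sum>j | j < p \<and> p + j \<in> W. h (p + j))"
    by (simp add: sum.reindex)
  have "card W = card ?U + card ?V"
    by (subst (1) W, rule card_Un_disjoint) (use disj in auto)
  then show "card W = card {i. i < p \<and> i \<in> W} + card {j. j < p \<and> p + j \<in> W}"
    by (simp add: card_image)
qed

abbreviation qqr_codeword :: "nat \<Rightarrow> nat set \<Rightarrow> bit Matrix.vec" where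
  "qqr_codeword p S \<equiv> coeff_vec p (cyclic_mult p (set_poly (quad_residues p)) (set_poly S)) @\<^sub>v
      coeff_vec p (cyclic_mult p (set_poly (quad_nonresidues p)) (set_poly S))"

lemma qqr_codeword_singleton:
  assumes "s < p" "i < p"
  shows "qqr_codeword p {s} $ i = of_bool ((i + (p - s)) mod p \<in> quad_residues p)"
    and "qqr_codeword p {s} $ (p + i) = of_bool ((i + (p - s)) mod p \<in> quad_nonresidues p)"
proof -
  have "quad_residues p \<subseteq> {..<p}" "quad_nonresidues p \<subseteq> {..<p}"
    by (auto simp: quad_residues_def quad_nonresidues_def)
  then show "qqr_codeword p {s} $ i = of_bool ((i + (p - s)) mod p \<in> quad_residues p)"
    and "qqr_codeword p {s} $ (p + i) = of_bool ((i + (p - s)) mod p \<in> quad_nonresidues p)"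
    using assms by (simp_all add: coeff_vec_def coeff_cyclic_mult_singleton)
qed

lemma to_ac_of_bool: "to_ac (of_bool b) = of_bool b"
  by (cases b) simp_all

text \<open>A set \<open>W\<close> on which all codewords sum to 0 is the support of a word of the
  dual code, so a nonzero dual word of weight \<open>d\<close> must satisfy
  \<open>5 ^ d \<ge> p\<close>.\<close>

theorem qqr_code_dual_distance:
  assumes p: "prime p" "2 < p" and W: "W \<subseteq> {..<2 * p}" "W \<noteq> {}" "5 ^ card W < p"
  shows "\<exists>c\<in>qqr_code p. (\<Sum>i\<in>W. c $ i) = 1"
proof (rule ccontr)
  assume contr: "\<not> ?thesis"
  let ?Q = "quad_residues p" and ?N = "quad_nonresidues p"
  \<comment> \<open>The codewords of singletons are the simultaneous cyclic shifts of the generating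
    pair; they supply \<open>p\<close> parity equations.\<close>
  have orth: "(\<Sum>i\<in>W. qqr_codeword p {s} $ i) = 0" if "s < p" for s
  proof -
    have "qqr_codeword p {s} \<in> qqr_code p"
      using that by (auto simp: qqr_code_def)
    with contr show ?thesis
      using bit_not_one_iff by blast
  qed
  have Q: "?Q \<subseteq> {..<p}" and N: "?N \<subseteq> {..<p}"
    by (auto simp: quad_residues_def quad_nonresidues_def)
  define U where "U = {i. i < p \<and> i \<in> W}"
  define V where "V = {j. j < p \<and> p + j \<in> W}"
  have "finite W"
    using W(1) finite_subset by blast
  then have "1 \<le> card W"
    using W(2) by (simp add: Suc_leI card_gt_0_iff)
  then have "5 ^ 1 \<le> (5::nat) ^ card W"
    by (rule power_increasing) simp
  with W(3) have "5 < p" by simp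
  moreover have "odd p"
    using p by (intro prime_odd_nat)
  \<comment> \<open>The exponents spread over at most \<open>2 * (p div 5)\<close>, below the number
    \<open>(p - 1) div 2\<close> of roots. Equality holds at \<open>p = 5\<close>, so the strict
    bound \<open>5 < p\<close> matters; it comes from \<open>W\<close> being nonempty.\<close>
  ultimately have size: "2 * (p div 5) < (p - 1) div 2"
    by presburger
  obtain \<zeta> :: "bit alg_closure" where \<zeta>: "\<zeta> ^ p = 1" "\<zeta> \<noteq> 1"
  proof (rule exists_root_of_unity)
    show "1 < p" using p by simp
    obtain m where "p = 2 * m + 1"
      using \<open>odd p\<close> by (rule oddE)
    then have "(of_nat p :: bit) = 1" by simp
    then show "(of_nat p :: bit alg_closure) \<noteq> 0"
      by (metis to_ac_of_nat to_ac_1 zero_neq_one)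
  qed
  \<comment> \<open>\<open>\<xi>\<close> is the inverse of \<open>\<zeta>\<close>.\<close>
  define \<xi> where "\<xi> = \<zeta> ^ (p - 1)"
  have inv: "\<xi> * \<zeta> = 1"
    using \<zeta>(1) p by (simp add: \<xi>_def flip: power_Suc2)
  have \<xi>: "\<xi> ^ p = 1" "\<xi> \<noteq> 1"
    using \<zeta> inv by (auto simp: \<xi>_def) (metis mult.commute power_mult power_one)
  \<comment> \<open>These are the values at \<open>\<zeta> ^ k\<close> of the residue and nonresidue
    polynomials; \<open>gQ 1\<close> and \<open>gN 1\<close> are the two Gauss sums \<alpha> and
    \<beta>.\<close>
  define gQ where "gQ k = (\<Sum>a\<in>?Q. (\<zeta> ^ k) ^ a)" for k
  define gN where "gN k = (\<Sum>a\<in>?N. (\<zeta> ^ k) ^ a)" for k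
  \<comment> \<open>Fourier transform of the parity equations: weight the equation for the shift
    \<open>s\<close> by \<open>\<xi> ^ (k * s)\<close> and add over all \<open>s\<close>.\<close>
  have main: "(\<Sum>i\<in>U \<union> V. (of_bool (i \<in> U) * gQ k + of_bool (i \<in> V) * gN k) * \<xi> ^ (k * i)) = 0" for k
  proof -
    have \<omega>: "(\<xi> ^ k) ^ p = 1" "\<xi> ^ k * \<zeta> ^ k = 1"
      using \<xi>(1) inv by (metis mult.commute power_mult power_one, simp flip: power_mult_distrib)
    let ?c = "\<lambda>s i. to_ac (qqr_codeword p {s} $ i)"
    have "0 = (\<Sum>s<p. (\<xi> ^ k) ^ s * to_ac (\<Sum>i\<in>W. qqr_codeword p {s} $ i))"
      by (simp add: orth del: index_append_vec)
    also have "\<dots> = (\<Sum>s<p. \<Sum>i\<in>W. (\<xi> ^ k) ^ s * ?c s i)"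
      by (simp only: to_ac_sum sum_distrib_left)
    also have "\<dots> = (\<Sum>i\<in>W. \<Sum>s<p. (\<xi> ^ k) ^ s * ?c s i)"
      by (rule sum.swap)
    also have "\<dots> = (\<Sum>i\<in>U. \<Sum>s<p. (\<xi> ^ k) ^ s * ?c s i) + (\<Sum>i\<in>V. \<Sum>s<p. (\<xi> ^ k) ^ s * ?c s (p + i))"
      unfolding U_def V_def by (rule sum_split_halves(1)[OF W(1)])
    also have "(\<Sum>i\<in>U. \<Sum>s<p. (\<xi> ^ k) ^ s * ?c s i)
        = (\<Sum>i\<in>U. \<Sum>s<p. (\<xi> ^ k) ^ s * of_bool ((i + (p - s)) mod p \<in> ?Q))"
      by (intro sum.cong refl) (simp add: U_def qqr_codeword_singleton(1) to_ac_of_bool del: index_append_vec)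
    also have "\<dots> = (\<Sum>i\<in>U. (\<xi> ^ k) ^ i * gQ k)"
      unfolding gQ_def by (intro sum.cong refl sum_shifted_indicator \<omega> Q) (simp add: U_def)
    also have "(\<Sum>i\<in>V. \<Sum>s<p. (\<xi> ^ k) ^ s * ?c s (p + i))
        = (\<Sum>i\<in>V. \<Sum>s<p. (\<xi> ^ k) ^ s * of_bool ((i + (p - s)) mod p \<in> ?N))"
      by (intro sum.cong refl) (simp add: V_def qqr_codeword_singleton(2) to_ac_of_bool del: index_append_vec)
    also have "\<dots> = (\<Sum>i\<in>V. (\<xi> ^ k) ^ i * gN k)"
      unfolding gN_def by (intro sum.cong refl sum_shifted_indicator \<omega> N) (simp add: V_def)
    also have "(\<Sum>i\<in>U. (\<xi> ^ k) ^ i * gQ k) = (\<Sum>i\<in>U \<union> V. of_bool (i \<in> U) * gQ k * \<xi> ^ (k * i))"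
      by (intro sum.mono_neutral_cong_left) (auto simp: U_def V_def power_mult)
    also have "(\<Sum>i\<in>V. (\<xi> ^ k) ^ i * gN k) = (\<Sum>i\<in>U \<union> V. of_bool (i \<in> V) * gN k * \<xi> ^ (k * i))"
      by (intro sum.mono_neutral_cong_left) (auto simp: U_def V_def power_mult)
    finally show ?thesis
      by (simp add: distrib_right sum.distrib)
  qed
  have gauss: "gQ k = (if k \<in> ?Q then gQ 1 else gN 1)" "gN k = (if k \<in> ?Q then gN 1 else gQ 1)"
    if "k \<in> ?Q \<union> ?N" for k
  proof -
    have g: "gQ k = (\<Sum>a | a < p \<and> Legendre a p = 1. \<zeta> ^ (k * a))"
      "gN k = (\<Sum>a | a < p \<and> Legendre a p = - 1. \<zeta> ^ (k * a))" for k
      using p by (simp_all add: gQ_def gN_def quad_residues_eq_Legendre quad_nonresidues_eq_Legendre power_mult)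
    have L: "Legendre k p = (if k \<in> ?Q then 1 else - 1)"
      using that p by (auto simp: quad_residues_eq_Legendre quad_nonresidues_eq_Legendre)
    then have nd: "\<not> p dvd k"
      using Legendre_eq_0_iff[of k p] by (simp split: if_splits)
    show "gQ k = (if k \<in> ?Q then gQ 1 else gN 1)" "gN k = (if k \<in> ?Q then gN 1 else gQ 1)"
      unfolding g sum_Legendre_class[OF p nd \<zeta>(1)] L by simp_all
  qed
  have "?Q \<inter> ?N = {}"
    by (auto simp: quad_residues_def quad_nonresidues_def)
  have M: "U \<union> V \<subseteq> {..<p}"
    by (auto simp: U_def V_def)
  have "card (U \<union> V) \<le> card W"
    unfolding sum_split_halves(2)[OF W(1)] U_def V_def by (rule card_Un_le)
  then have "(5::nat) ^ card (U \<union> V) \<le> 5 ^ card W"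
    by (intro power_increasing) simp_all
  then have small: "5 ^ card (U \<union> V) < p"
    using W(3) by (rule le_less_trans)
  have "U \<union> V \<noteq> {}"
    using sum_split_halves(2)[OF W(1), folded U_def V_def] \<open>1 \<le> card W\<close>
    by (metis Un_empty add_0 card.empty not_one_le_zero)
  then obtain i where i: "i \<in> U \<union> V" by blast
  \<comment> \<open>On residues \<open>k\<close> the coefficients in \<open>main\<close> are
    constant in \<open>k\<close>, so the sparse sum has enough zeros; on nonresidues the same holds
    with the two Gauss sums exchanged.\<close>
  have "of_bool (i \<in> U) * gQ 1 + of_bool (i \<in> V) * gN 1 = 0"
  proof (rule sparse_polynomial_zeros[OF p(1) \<xi> M small Q _ _ i])
    fix k assume "k \<in> ?Q"
    then show "(\<Sum>i\<in>U \<union> V. (of_bool (i \<in> U) * gQ 1 + of_bool (i \<in> V) * gN 1) * \<xi> ^ (k * i)) = 0"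
      using main[of k] gauss[of k] by simp
  qed (use size in \<open>simp only: card_quad_residues[OF p]\<close>)
  moreover have "of_bool (i \<in> U) * gN 1 + of_bool (i \<in> V) * gQ 1 = 0"
  proof (rule sparse_polynomial_zeros[OF p(1) \<xi> M small N _ _ i])
    fix k assume "k \<in> ?N"
    moreover from this have "k \<notin> ?Q"
      using \<open>?Q \<inter> ?N = {}\<close> by blast
    ultimately show "(\<Sum>i\<in>U \<union> V. (of_bool (i \<in> U) * gN 1 + of_bool (i \<in> V) * gQ 1) * \<xi> ^ (k * i)) = 0"
      using main[of k] gauss[of k] by simp
  qed (use size in \<open>simp only: card_quad_residues[OF p]\<close>)
  \<comment> \<open>If \<open>i\<close> lies in only one of \<open>U\<close> and \<open>V\<close>,
    both Gauss sums vanish; if it lies in both, either equation is the claim.\<close>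
  ultimately have "gQ 1 + gN 1 = 0"
    using i by (cases "i \<in> U"; cases "i \<in> V") (simp_all add: add.commute)
  \<comment> \<open>All powers of \<open>\<zeta>\<close> with exponent below \<open>p\<close> add up
    to 0, and the Gauss sums together omit just the exponent 0.\<close>
  moreover have "gQ 1 + gN 1 = - 1"
  proof -
    have "0 = (\<Sum>a<p. \<zeta> ^ a)"
      using \<zeta> power_diff_1_eq[of \<zeta> p] by simp
    also have "{..<p} = insert 0 (?Q \<union> ?N)"
      using quad_residues_Un_nonresidues p by auto
    also have "(\<Sum>a\<in>\<dots>. \<zeta> ^ a) = 1 + (\<Sum>a\<in>?Q \<union> ?N. \<zeta> ^ a)"
      using quad_residues_Un_nonresidues[of p] p by (subst sum.insert) auto
    also have "(\<Sum>a\<in>?Q \<union> ?N. \<zeta> ^ a) = gQ 1 + gN 1"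
      using \<open>?Q \<inter> ?N = {}\<close> finite_subset[OF Q] finite_subset[OF N]
      by (simp add: gQ_def gN_def sum.union_disjoint)
    finally show ?thesis
      by (metis add.commute add_eq_0_iff2)
  qed
  ultimately show False by simp
qed

section \<open>Almost independent signs\<close>

text \<open>This says that the \<open>n\<close> signs of a uniformly chosen element of
  \<open>A\<close> are fair and \<open>T\<close>-wise independent, expressed through the vanishing
  of all mixed products.\<close>

definition indep_signs :: "nat \<Rightarrow> nat \<Rightarrow> 'a set \<Rightarrow> (nat \<Rightarrow> 'a \<Rightarrow> real) \<Rightarrow> bool" where
  "indep_signs n T A e \<longleftrightarrow> finite A \<and> A \<noteq> {} \<and> (\<forall>i<n. \<forall>a\<in>A. e i a \<in> {-1, 1}) \<and>
     (\<forall>W\<subseteq>{..<n}. W \<noteq> {} \<longrightarrow> card W \<le> T \<longrightarrow> (\<Sum>a\<in>A. \<Prod>i\<in>W. e i a) = 0)"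

text \<open>The extra product over \<open>V\<close> makes the induction work: as signs square to 1,
  multiplying by one more sign toggles an index in \<open>V\<close>, whose size grows by at most one
  while \<open>k\<close> drops by one.\<close>

lemma indep_signs_moment_eq:
  assumes A: "indep_signs n T A e" and B: "indep_signs n T B f"
    and "V \<subseteq> {..<n}" "card V + k \<le> T"
  shows "(\<Sum>a\<in>A. (\<Prod>i\<in>V. e i a) * (\<Sum>i<n. e i a) ^ k) / card A
    = (\<Sum>b\<in>B. (\<Prod>i\<in>V. f i b) * (\<Sum>i<n. f i b) ^ k) / card B"
  using assms(3,4)
proof (induction k arbitrary: V)
  case 0
  show ?case
  proof (cases "V = {}")
    case True
    then show ?thesis
      using A B by (simp add: indep_signs_def)
  next
    case False
    then have "(\<Sum>a\<in>A. \<Prod>i\<in>V. e i a) = 0" "(\<Sum>b\<in>B. \<Prod>i\<in>V. f i b) = 0"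
      using A B 0 by (simp_all add: indep_signs_def)
    then show ?thesis by simp
  qed
next
  case (Suc k)
  define V' where "V' i = (if i \<in> V then V - {i} else insert i V)" for i
  have fin: "finite V"
    using Suc.prems(1) finite_subset by blast
  have V': "V' i \<subseteq> {..<n}" "card (V' i) + k \<le> T" if "i < n" for i
    using Suc.prems fin that by (auto simp: V'_def card_insert_if card_Diff_singleton)
  have expand: "(\<Sum>a\<in>X. (\<Prod>i\<in>V. g i a) * (\<Sum>i<n. g i a) ^ Suc k)
      = (\<Sum>i<n. \<Sum>a\<in>X. (\<Prod>j\<in>V' i. g j a) * (\<Sum>i<n. g i a) ^ k)"
    if "indep_signs n T X g" for X :: "'c set" and g
  proof -
    have flip: "(\<Prod>j\<in>V. g j a) * g i a = (\<Prod>j\<in>V' i. g j a)" if "a \<in> X" "i < n" for a i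
    proof (cases "i \<in> V")
      case True
      have "g i a * g i a = 1"
        using \<open>indep_signs n T X g\<close> that unfolding indep_signs_def by fastforce
      then show ?thesis
        using True prod.remove[OF fin True, of "\<lambda>j. g j a"] by (simp add: V'_def)
    next
      case False
      then show ?thesis
        using fin by (simp add: V'_def)
    qed
    have "(\<Sum>a\<in>X. (\<Prod>i\<in>V. g i a) * (\<Sum>i<n. g i a) ^ Suc k)
        = (\<Sum>a\<in>X. \<Sum>i<n. ((\<Prod>j\<in>V. g j a) * g i a) * (\<Sum>i<n. g i a) ^ k)"
      by (simp add: sum_distrib_left sum_distrib_right mult_ac)
    also have "\<dots> = (\<Sum>a\<in>X. \<Sum>i<n. (\<Prod>j\<in>V' i. g j a) * (\<Sum>i<n. g i a) ^ k)"
      by (intro sum.cong refl) (simp add: flip)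
    finally show ?thesis
      by (subst (asm) sum.swap)
  qed
  show ?case
    unfolding expand[OF A] expand[OF B] sum_divide_distrib[where A = "{..<n}"]
    using Suc.IH V' by (intro sum.cong) auto
qed

section \<open>The uniform cube as reference model\<close>

definition cube_sign :: "nat \<Rightarrow> nat set \<Rightarrow> real" where
  "cube_sign i X = (if i \<in> X then 1 else - 1)"

lemma sum_cube_prod:
  fixes f g :: "nat \<Rightarrow> 'a::comm_semiring_1"
  shows "(\<Sum>X\<in>Pow {..<n}. \<Prod>i<n. if i \<in> X then f i else g i) = (\<Prod>i<n. f i + g i)"
proof -
  have "(\<Prod>i<n. if i \<in> X then f i else g i) = (\<Prod>i\<in>X. f i) * (\<Prod>i\<in>{..<n}-X. g i)"
    if "X \<in> Pow {..<n}" for X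
    using that by (subst prod.If_cases) (auto simp: Int_absorb1 Diff_eq intro!: arg_cong2[where f="(*)"] prod.cong)
  then show ?thesis
    by (subst prod_add) (auto intro: sum.cong)
qed

text \<open>The average factors over the coordinates, and each coordinate in \<open>W\<close>
  contributes the factor \<open>1 + (- 1)\<close>.\<close>

lemma indep_signs_cube: "indep_signs n T (Pow {..<n}) cube_sign"
  unfolding indep_signs_def
proof (intro conjI allI impI)
  fix W assume W: "W \<subseteq> {..<n}" "W \<noteq> {}"
  have "(\<Prod>i\<in>W. cube_sign i X) = (\<Prod>i<n. if i \<in> X then 1 else if i \<in> W then - 1 else 1)" for X
  proof -
    have "(\<Prod>i\<in>W. cube_sign i X) = (\<Prod>i<n. if i \<in> W then cube_sign i X else 1)"
      using W(1) prod.inter_restrict[of "{..<n}" "\<lambda>i. cube_sign i X" W] by (simp add: Int_absorb1)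
    also have "\<dots> = (\<Prod>i<n. if i \<in> X then 1 else if i \<in> W then - 1 else 1)"
      by (intro prod.cong) (auto simp: cube_sign_def)
    finally show ?thesis .
  qed
  then have "(\<Sum>X\<in>Pow {..<n}. \<Prod>i\<in>W. cube_sign i X) = (\<Prod>i<n. 1 + (if i \<in> W then - 1 else 1))"
    by (simp add: sum_cube_prod)
  also have "\<dots> = 0"
    using W by (auto intro!: prod_zero)
  finally show "(\<Sum>X\<in>Pow {..<n}. \<Prod>i\<in>W. cube_sign i X) = 0" .
qed (auto simp: cube_sign_def)

text \<open>Each independent sign contributes \<open>(exp c + exp (- c)) / 2\<close>. Real
  \<open>c\<close> serves to bound moments, imaginary \<open>c\<close> gives the characteristic
  function.\<close>

lemma cube_exp_average:
  fixes c :: "'a::{real_normed_field, banach}"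
  shows "(\<Sum>X\<in>Pow {..<n}. exp (c * of_real (\<Sum>i<n. cube_sign i X))) / 2 ^ n = cosh c ^ n"
proof -
  have "exp (c * of_real (\<Sum>i<n. cube_sign i X)) = (\<Prod>i<n. if i \<in> X then exp c else exp (- c))" for X
    by (simp add: of_real_sum sum_distrib_left exp_sum cube_sign_def if_distrib[of of_real]
        if_distrib[of "\<lambda>x. c * x"] if_distrib[of exp] cong: if_cong)
  then have "(\<Sum>X\<in>Pow {..<n}. exp (c * of_real (\<Sum>i<n. cube_sign i X))) = (\<Prod>i<n. exp c + exp (- c))"
    by (simp add: sum_cube_prod)
  then show ?thesis
    by (simp add: cosh_def power_divide scaleR_conv_of_real field_simps flip: power_mult_distrib)
qed

text \<open>A single term of the series of \<open>exp |x|\<close> is at most its sum; evenness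
  removes the absolute value.\<close>

lemma even_power_le_fact_mult_exp:
  fixes x :: real
  assumes "even k"
  shows "x ^ k \<le> fact k * (exp x + exp (- x))"
proof -
  have "\<bar>x\<bar> ^ k / fact k \<le> exp \<bar>x\<bar>"
    using sum_le_suminf[OF sums_summable[OF exp_converges[of "\<bar>x\<bar>"]], of "{k}"]
      sums_unique[OF exp_converges[of "\<bar>x\<bar>"]]
    by (simp add: field_simps)
  also have "\<dots> \<le> exp x + exp (- x)"
    by (cases "x \<ge> 0") (simp_all add: abs_if)
  finally show ?thesis
    using assms by (simp add: field_simps power_even_abs)
qed

text \<open>Dominate the power by exponentials with a free scale \<open>s\<close> and average them
  exactly. A scale above \<open>|t|\<close> later makes the Taylor error decay geometrically in
  \<open>k\<close>.\<close>

lemma cube_even_moment_le: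
  assumes "even k" "0 < s"
  shows "(\<Sum>X\<in>Pow {..<n}. ((\<Sum>i<n. cube_sign i X) / sqrt n) ^ k) / 2 ^ n
    \<le> fact k / s ^ k * (2 * cosh (s / sqrt n) ^ n)"
proof -
  have "(\<Sum>X\<in>Pow {..<n}. ((\<Sum>i<n. cube_sign i X) / sqrt n) ^ k)
      = (\<Sum>X\<in>Pow {..<n}. (s / sqrt n * (\<Sum>i<n. cube_sign i X)) ^ k) / s ^ k"
    using assms(2) by (simp add: power_mult_distrib power_divide flip: sum_divide_distrib sum_distrib_left)
  also have "\<dots> \<le> (\<Sum>X\<in>Pow {..<n}. fact k * (exp (s / sqrt n * (\<Sum>i<n. cube_sign i X))
      + exp (- (s / sqrt n) * (\<Sum>i<n. cube_sign i X)))) / s ^ k"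
    using assms even_power_le_fact_mult_exp[OF assms(1)]
    by (intro divide_right_mono sum_mono) simp_all
  also have "\<dots> = fact k / s ^ k * ((\<Sum>X\<in>Pow {..<n}. exp (s / sqrt n * (\<Sum>i<n. cube_sign i X)))
      + (\<Sum>X\<in>Pow {..<n}. exp (- (s / sqrt n) * (\<Sum>i<n. cube_sign i X))))"
    by (simp add: sum.distrib distrib_left add_divide_distrib flip: sum_distrib_left)
  finally have "(\<Sum>X\<in>Pow {..<n}. ((\<Sum>i<n. cube_sign i X) / sqrt n) ^ k) / 2 ^ n
    \<le> \<dots> / 2 ^ n"
    by (rule divide_right_mono) simp
  also have "\<dots> = fact k / s ^ k * ((\<Sum>X\<in>Pow {..<n}. exp (s / sqrt n * (\<Sum>i<n. cube_sign i X))) / 2 ^ n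
      + (\<Sum>X\<in>Pow {..<n}. exp (- (s / sqrt n) * (\<Sum>i<n. cube_sign i X))) / 2 ^ n)"
    by (simp add: add_divide_distrib distrib_left)
  also have "(\<Sum>X\<in>Pow {..<n}. exp (s / sqrt n * (\<Sum>i<n. cube_sign i X))) / 2 ^ n = cosh (s / sqrt n) ^ n"
    using cube_exp_average[where c = "s / sqrt n" and n = n] by simp
  also have "(\<Sum>X\<in>Pow {..<n}. exp (- (s / sqrt n) * (\<Sum>i<n. cube_sign i X))) / 2 ^ n = cosh (s / sqrt n) ^ n"
    using cube_exp_average[where c = "- (s / sqrt n)" and n = n] by simp
  finally show ?thesis by (simp only: mult_2)
qed

text \<open>The Taylor polynomials of degree \<open>k\<close> have equal averages because the
  moments up to \<open>k\<close> agree. Each of the two remainders costs twice the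
  \<open>k\<close>-th moment term, and the \<open>k\<close>-th moments agree as well.\<close>

lemma indep_signs_char_diff:
  assumes A: "indep_signs n k A e" and B: "indep_signs n k B f" and "even k"
  defines "S \<equiv> \<lambda>a. (\<Sum>i<n. e i a) / sqrt n" and "S' \<equiv> \<lambda>b. (\<Sum>i<n. f i b) / sqrt n"
  shows "cmod ((\<Sum>a\<in>A. iexp (t * S a)) / card A - (\<Sum>b\<in>B. iexp (t * S' b)) / card B)
    \<le> 4 * \<bar>t\<bar> ^ k / fact k * ((\<Sum>b\<in>B. S' b ^ k) / card B)"
proof -
  define P where "P x = (\<Sum>j\<le>k. (\<i> * complex_of_real x) ^ j / fact j)" for x
  have moment: "(\<Sum>a\<in>A. S a ^ j) / card A = (\<Sum>b\<in>B. S' b ^ j) / card B" if "j \<le> k" for j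
  proof -
    have scale: "(\<Sum>a\<in>X. ((\<Sum>i<n. g i a) / sqrt n) ^ j) / card X
        = (\<Sum>a\<in>X. (\<Sum>i<n. g i a) ^ j) / card X / sqrt n ^ j" for X :: "'c set" and g
      by (simp add: power_divide flip: sum_divide_distrib)
    show ?thesis
      using indep_signs_moment_eq[OF A B, of "{}" j] that by (simp add: S_def S'_def scale)
  qed
  have poly: "(\<Sum>a\<in>X. P (t * g a)) / card X
      = (\<Sum>j\<le>k. (\<i> * t) ^ j / fact j * complex_of_real ((\<Sum>a\<in>X. g a ^ j) / card X))"
    for X :: "'c set" and g
  proof -
    have "(\<Sum>a\<in>X. P (t * g a)) = (\<Sum>j\<le>k. \<Sum>a\<in>X. (\<i> * t) ^ j / fact j * complex_of_real (g a ^ j))"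
      unfolding P_def by (subst sum.swap) (simp add: power_mult_distrib mult_ac)
    then show ?thesis
      by (simp add: sum_distrib_left sum_divide_distrib)
  qed
  have bound: "cmod ((\<Sum>a\<in>X. iexp (t * g a)) / card X - (\<Sum>a\<in>X. P (t * g a)) / card X)
      \<le> 2 * \<bar>t\<bar> ^ k / fact k * ((\<Sum>a\<in>X. g a ^ k) / card X)" for X :: "'c set" and g
  proof -
    have "(\<Sum>a\<in>X. iexp (t * g a)) / card X - (\<Sum>a\<in>X. P (t * g a)) / card X
        = (\<Sum>a\<in>X. iexp (t * g a) - P (t * g a)) / card X"
      by (simp add: sum_subtractf diff_divide_distrib)
    also have "cmod \<dots> \<le> (\<Sum>a\<in>X. 2 * \<bar>t * g a\<bar> ^ k / fact k) / card X"
      unfolding norm_divide P_def norm_of_nat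
      by (intro divide_right_mono order_trans[OF norm_sum] sum_mono iexp_approx2) simp
    also have "\<dots> = 2 * \<bar>t\<bar> ^ k / fact k * ((\<Sum>a\<in>X. g a ^ k) / card X)"
    proof -
      have "(\<Sum>a\<in>X. 2 * \<bar>t * g a\<bar> ^ k / fact k) = 2 * \<bar>t\<bar> ^ k / fact k * (\<Sum>a\<in>X. g a ^ k)"
        unfolding sum_distrib_left using \<open>even k\<close>
        by (intro sum.cong) (simp_all add: abs_mult power_mult_distrib power_even_abs)
      then show ?thesis by simp
    qed
    finally show ?thesis .
  qed
  have "(\<Sum>a\<in>A. P (t * S a)) / card A = (\<Sum>b\<in>B. P (t * S' b)) / card B"
    unfolding poly by (intro sum.cong refl) (simp only: moment atMost_iff)
  with norm_triangle_ineq4[of "(\<Sum>a\<in>A. iexp (t * S a)) / card A - (\<Sum>a\<in>A. P (t * S a)) / card A"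
      "(\<Sum>b\<in>B. iexp (t * S' b)) / card B - (\<Sum>b\<in>B. P (t * S' b)) / card B"]
  have "cmod ((\<Sum>a\<in>A. iexp (t * S a)) / card A - (\<Sum>b\<in>B. iexp (t * S' b)) / card B)
    \<le> cmod ((\<Sum>a\<in>A. iexp (t * S a)) / card A - (\<Sum>a\<in>A. P (t * S a)) / card A)
      + cmod ((\<Sum>b\<in>B. iexp (t * S' b)) / card B - (\<Sum>b\<in>B. P (t * S' b)) / card B)"
    by (simp only: diff_diff_eq2 diff_add_cancel)
  also have "\<dots> \<le> 2 * \<bar>t\<bar> ^ k / fact k * ((\<Sum>a\<in>A. S a ^ k) / card A)
      + 2 * \<bar>t\<bar> ^ k / fact k * ((\<Sum>b\<in>B. S' b ^ k) / card B)"
    by (intro add_mono bound)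
  also have "\<dots> = 4 * \<bar>t\<bar> ^ k / fact k * ((\<Sum>b\<in>B. S' b ^ k) / card B)"
    by (simp only: moment[OF le_refl])
  finally show ?thesis .
qed

lemma cos_power_tendsto: "(\<lambda>n. cos (t / sqrt (real n)) ^ n) \<longlonglongrightarrow> exp (- (t\<^sup>2) / 2)"
  by (real_asymp simp: power2_eq_square)

lemma cosh_power_tendsto: "(\<lambda>n. cosh (t / sqrt (real n)) ^ n) \<longlonglongrightarrow> exp (t\<^sup>2 / 2)"
  by (real_asymp simp: power2_eq_square)

lemma cube_char_average:
  fixes t :: real
  shows "(\<Sum>X\<in>Pow {..<n}. iexp (t * ((\<Sum>i<n. cube_sign i X) / sqrt n))) / card (Pow {..<n})
    = complex_of_real (cos (t / sqrt n) ^ n)"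
proof -
  have "cosh (\<i> * complex_of_real x) = complex_of_real (cos x)" for x
    by (simp add: cosh_field_def cos_exp_eq flip: cos_of_real)
  from this[of "t / sqrt n"] show ?thesis
    using cube_exp_average[where c = "\<i> * complex_of_real (t / sqrt n)" and n = n]
    by (simp add: card_Pow mult_ac)
qed

text \<open>The cube has characteristic function \<open>cos (t / sqrt n) ^ n\<close>, which tends to
  the Gaussian one, and the difference from it is at most
  \<open>8 * (|t| / s) ^ k * cosh (s / sqrt n) ^ n\<close>.\<close>

lemma indep_signs_char_tendsto:
  fixes n :: "'b \<Rightarrow> nat" and A :: "'b \<Rightarrow> 'a set" and e :: "'b \<Rightarrow> nat \<Rightarrow> 'a \<Rightarrow> real" and t :: real
  assumes n: "filterlim n at_top F"
    and indep: "\<And>k. \<forall>\<^sub>F p in F. indep_signs (n p) k (A p) (e p)"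
  shows "((\<lambda>p. (\<Sum>a\<in>A p. iexp (t * ((\<Sum>i<n p. e p i a) / sqrt (n p)))) / card (A p))
    \<longlongrightarrow> complex_of_real (exp (- (t\<^sup>2) / 2))) F"
proof -
  define \<phi> where "\<phi> p = (\<Sum>a\<in>A p. iexp (t * ((\<Sum>i<n p. e p i a) / sqrt (n p)))) / card (A p)" for p
  define \<psi> where "\<psi> m = complex_of_real (cos (t / sqrt (real m)) ^ m)" for m
  have \<psi>: "((\<lambda>p. \<psi> (n p)) \<longlongrightarrow> complex_of_real (exp (- (t\<^sup>2) / 2))) F"
    unfolding \<psi>_def by (intro tendsto_of_real filterlim_compose[OF cos_power_tendsto n])
  \<comment> \<open>This keeps \<open>|t| / s\<close> below 1 and \<open>s\<close> positive even for
    \<open>t = 0\<close>.\<close>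
  define s where "s = 2 * \<bar>t\<bar> + 1"
  \<comment> \<open>\<open>K\<close> exceeds the limit of the \<open>cosh\<close> powers, so it
    bounds them eventually.\<close>
  define K where "K = exp (s\<^sup>2 / 2) + 1"
  have s: "0 < s" "\<bar>t\<bar> / s < 1"
    by (auto simp: s_def)
  have K: "0 < K"
    by (simp add: K_def add_pos_pos)
  have "(\<lambda>m. cosh (s / sqrt (real m)) ^ m) \<longlonglongrightarrow> exp (s\<^sup>2 / 2)"
    by (rule cosh_power_tendsto)
  then have "\<forall>\<^sub>F m in at_top. cosh (s / sqrt (real m)) ^ m < K"
    by (rule order_tendstoD) (simp add: K_def)
  then have cosh: "\<forall>\<^sub>F p in F. cosh (s / sqrt (real (n p))) ^ n p < K"
    using n by (rule eventually_compose_filterlim)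
  have "((\<lambda>p. \<phi> p - \<psi> (n p)) \<longlongrightarrow> 0) F"
  proof (rule tendstoI)
    fix \<epsilon> :: real assume \<epsilon>: "0 < \<epsilon>"
    have "(\<lambda>k. (\<bar>t\<bar> / s) ^ k) \<longlonglongrightarrow> 0"
      using s by (intro LIMSEQ_realpow_zero) auto
    then have "\<forall>\<^sub>F k in at_top. (\<bar>t\<bar> / s) ^ k < \<epsilon> / (8 * K)"
      by (rule order_tendstoD) (use \<epsilon> K in simp)
    then obtain k0 where "\<And>k. k \<ge> k0 \<Longrightarrow> (\<bar>t\<bar> / s) ^ k < \<epsilon> / (8 * K)"
      by (auto simp: eventually_at_top_linorder)
    then have small: "(\<bar>t\<bar> / s) ^ (2 * k0) < \<epsilon> / (8 * K)"
      by simp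
    \<comment> \<open>The even order \<open>k\<close> is fixed by \<open>\<epsilon>\<close> before
      \<open>p\<close> grows.\<close>
    define k where "k = 2 * k0"
    show "\<forall>\<^sub>F p in F. dist (\<phi> p - \<psi> (n p)) 0 < \<epsilon>"
      using indep[of k] cosh
    proof eventually_elim
      case (elim p)
      let ?m = "n p"
      let ?S = "\<lambda>X. (\<Sum>i<?m. cube_sign i X) / sqrt ?m"
      have "cmod (\<phi> p - (\<Sum>X\<in>Pow {..<?m}. iexp (t * ?S X)) / card (Pow {..<?m}))
          \<le> 4 * \<bar>t\<bar> ^ k / fact k * ((\<Sum>X\<in>Pow {..<?m}. ?S X ^ k) / card (Pow {..<?m}))"
        unfolding \<phi>_def by (rule indep_signs_char_diff[OF elim(1) indep_signs_cube]) (simp add: k_def)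
      then have "cmod (\<phi> p - \<psi> ?m)
          \<le> 4 * \<bar>t\<bar> ^ k / fact k * ((\<Sum>X\<in>Pow {..<?m}. ?S X ^ k) / 2 ^ ?m)"
        unfolding cube_char_average \<psi>_def by (simp add: card_Pow)
      also have "\<dots> \<le> 4 * \<bar>t\<bar> ^ k / fact k * (fact k / s ^ k * (2 * cosh (s / sqrt ?m) ^ ?m))"
        by (intro mult_left_mono cube_even_moment_le s) (auto simp: k_def)
      also have "\<dots> = 8 * (\<bar>t\<bar> / s) ^ k * cosh (s / sqrt ?m) ^ ?m"
        by (simp add: power_divide)
      also have "\<dots> \<le> 8 * (\<bar>t\<bar> / s) ^ k * K"
        using elim(2) s(1) by (intro mult_left_mono) auto
      also have "\<dots> < \<epsilon>"
        using small K by (simp add: k_def field_simps)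
      finally show ?case
        by (simp add: dist_norm)
    qed
  qed
  from tendsto_add[OF this \<psi>] show ?thesis
    by (simp add: \<phi>_def)
qed

section \<open>From characteristic functions to distribution functions\<close>

lemma isCont_cdf_std_normal: "isCont (cdf std_normal_distribution) z"
proof -
  interpret real_distribution std_normal_distribution
    by (rule real_dist_normal_dist)
  have "emeasure std_normal_distribution {z} = 0"
    by (subst emeasure_density) (auto intro!: nn_integral_zero' AE_I[of _ _ "{z}"] simp: nn_integral_0_iff_AE)
  then show ?thesis
    by (simp add: isCont_cdf measure_def)
qed

theorem indep_signs_central_limit:
  fixes n :: "nat \<Rightarrow> nat" and A :: "nat \<Rightarrow> 'a set" and e :: "nat \<Rightarrow> nat \<Rightarrow> 'a \<Rightarrow> real" and z :: real
  defines "S \<equiv> \<lambda>p a. (\<Sum>i<n p. e p i a) / sqrt (n p)"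
  assumes n: "filterlim n at_top (inf at_top (principal P))"
    and A: "\<And>p. p \<in> P \<Longrightarrow> finite (A p) \<and> A p \<noteq> {}"
    and indep: "\<And>k. \<forall>\<^sub>F p in inf at_top (principal P). indep_signs (n p) k (A p) (e p)"
  shows "((\<lambda>p. card {a \<in> A p. S p a \<le> z} / card (A p)) \<longlongrightarrow> cdf std_normal_distribution z)
    (inf at_top (principal P))"
proof -
  \<comment> \<open>Levy's theorem is applied to a full sequence, so indices outside
    \<open>P\<close> are filled with the limit law itself; convergence on \<open>P\<close> and on
    its complement then combine.\<close>
  define D where "D p = (if p \<in> P then distr (measure_pmf (pmf_of_set (A p))) borel (S p)
    else std_normal_distribution)" for p
  have D: "real_distribution (D p)" for p
    by (auto simp: D_def real_dist_normal_dist intro!: prob_space.real_distribution_distr measure_pmf.prob_space_axioms)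
  have char: "char (D p) t = (\<Sum>a\<in>A p. iexp (t * S p a)) / card (A p)" if "p \<in> P" for p t
  proof -
    have "char (D p) t = (CLINT a|measure_pmf (pmf_of_set (A p)). iexp (t * S p a))"
      using that by (simp add: D_def char_def integral_distr)
    also have "\<dots> = (\<Sum>a\<in>A p. pmf (pmf_of_set (A p)) a *\<^sub>R iexp (t * S p a))"
      using A[OF that] by (intro integral_measure_pmf) auto
    also have "\<dots> = (\<Sum>a\<in>A p. iexp (t * S p a)) / card (A p)"
      using A[OF that] by (simp add: scaleR_conv_of_real sum_divide_distrib)
    finally show ?thesis .
  qed
  have "(\<lambda>p. char (D p) t) \<longlonglongrightarrow> char std_normal_distribution t" for t
  proof -
    have "((\<lambda>p. char (D p) t) \<longlongrightarrow> char std_normal_distribution t) (inf at_top (principal P))"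
      unfolding char_std_normal_distribution
      using indep_signs_char_tendsto[OF n indep, of t]
      by (rule Lim_transform_eventually) (auto simp: char S_def eventually_inf_principal)
    moreover have "((\<lambda>p. char (D p) t) \<longlongrightarrow> char std_normal_distribution t) (inf at_top (principal (- P)))"
      by (rule Lim_transform_eventually[OF tendsto_const]) (auto simp: D_def eventually_inf_principal)
    ultimately have "((\<lambda>p. char (D p) t) \<longlongrightarrow> char std_normal_distribution t)
        (sup (inf at_top (principal P)) (inf at_top (principal (- P))))"
      by (rule filterlim_sup)
    then show ?thesis
      by (simp add: sup_principal flip: inf_sup_distrib1)
  qed
  then have "weak_conv_m D std_normal_distribution"
    by (intro levy_continuity D real_dist_normal_dist)
  then have "(\<lambda>p. cdf (D p) z) \<longlonglongrightarrow> cdf std_normal_distribution z"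
    by (simp add: weak_conv_m_def weak_conv_def isCont_cdf_std_normal)
  then have "((\<lambda>p. cdf (D p) z) \<longlongrightarrow> cdf std_normal_distribution z) (inf at_top (principal P))"
    by (rule tendsto_mono[rotated]) simp
  then show ?thesis
  proof (rule Lim_transform_eventually)
    have "cdf (D p) z = card {a \<in> A p. S p a \<le> z} / card (A p)" if "p \<in> P" for p
    proof -
      have "cdf (D p) z = measure (measure_pmf (pmf_of_set (A p))) (S p -` {..z})"
        using that by (simp add: D_def cdf_def measure_distr)
      also have "\<dots> = card (A p \<inter> S p -` {..z}) / card (A p)"
        using A[OF that] by (simp add: measure_pmf_of_set)
      also have "A p \<inter> S p -` {..z} = {a \<in> A p. S p a \<le> z}"
        by auto
      finally show ?thesis .
    qed
    then show "\<forall>\<^sub>F p in inf at_top (principal P). cdf (D p) z = card {a \<in> A p. S p a \<le> z} / card (A p)"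
      by (simp add: eventually_inf_principal)
  qed
qed

section \<open>Weights of linear codes\<close>

lemma UNIV_bit: "UNIV = {0, 1 :: bit}"
  using bit_not_zero_iff by auto

lemma finite_carrier_vec_bit: "finite (carrier_vec n :: bit Matrix.vec set)"
proof (rule finite_surj)
  show "finite ({..<n} \<rightarrow>\<^sub>E (UNIV :: bit set))"
    by (intro finite_PiE) (simp_all add: UNIV_bit)
  show "carrier_vec n \<subseteq> Matrix.vec n ` ({..<n} \<rightarrow>\<^sub>E (UNIV :: bit set))"
  proof
    fix v :: "bit Matrix.vec" assume "v \<in> carrier_vec n"
    then have "v = Matrix.vec n (restrict (\<lambda>i. v $ i) {..<n})"
      by (intro eq_vecI) auto
    then show "v \<in> Matrix.vec n ` ({..<n} \<rightarrow>\<^sub>E (UNIV :: bit set))"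
      by (metis UNIV_I imageI restrict_PiE_iff)
  qed
qed

text \<open>Coordinates in a basis identify the code with all functions from the basis to the
  two-element field.\<close>

lemma card_code_eq_power_dim:
  assumes "VectorSpace.subspace class_ring C (module_vec TYPE(bit) n)"
  shows "card C = 2 ^ code_dim n C"
proof -
  interpret V: vec_space "TYPE(bit)" n .
  interpret W: vectorspace class_ring "V.V\<lparr>carrier := C\<rparr>"
    using assms by (rule V.subspace_is_vs)
  have "C \<subseteq> carrier_vec n"
    using assms by (auto simp: VectorSpace.subspace_def submodule_def module_vec_simps)
  then have fin: "finite C"
    using finite_carrier_vec_bit finite_subset by blast
  \<comment> \<open>The finite set \<open>C\<close> spans itself, so a finite basis exists.\<close>
  have "W.span C = C"
    using W.in_own_span[of C] W.span_closed by force
  then have "W.fin_dim"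
    unfolding W.fin_dim_def using fin by auto
  then obtain B where B: "finite B" "W.basis B"
    using W.finite_basis_exists by blast
  have BC: "B \<subseteq> carrier (V.V\<lparr>carrier := C\<rparr>)"
    using B(2) unfolding W.basis_def by blast
  have ex1: "\<forall>v. v \<in> C \<longrightarrow> (\<exists>!a. a \<in> B \<rightarrow>\<^sub>E carrier class_ring \<and> W.lincomb a B = v)"
    using W.basis_criterion[OF B(1) BC] B(2) by simp
  have "bij_betw (\<lambda>a. W.lincomb a B) (B \<rightarrow>\<^sub>E (UNIV :: bit set)) C"
    unfolding bij_betw_def inj_on_def
  proof (intro conjI ballI impI subset_antisym subsetI)
    fix a b assume "a \<in> B \<rightarrow>\<^sub>E (UNIV :: bit set)" "b \<in> B \<rightarrow>\<^sub>E (UNIV :: bit set)"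
      and eq: "W.lincomb a B = W.lincomb b B"
    moreover have "W.lincomb a B \<in> C"
      using W.lincomb_closed[OF BC] by (auto simp: class_field_def)
    ultimately show "a = b"
      using ex1 by (auto simp: class_field_def)
  next
    fix v assume "v \<in> (\<lambda>a. W.lincomb a B) ` (B \<rightarrow>\<^sub>E (UNIV :: bit set))"
    then show "v \<in> C"
      using W.lincomb_closed[OF BC] by (auto simp: class_field_def)
  next
    fix v assume "v \<in> C"
    then show "v \<in> (\<lambda>a. W.lincomb a B) ` (B \<rightarrow>\<^sub>E (UNIV :: bit set))"
      using ex1 by (auto simp: class_field_def)
  qed
  then have "card C = card (B \<rightarrow>\<^sub>E (UNIV :: bit set))"
    by (simp add: bij_betw_same_card)
  also have "\<dots> = 2 ^ card B"
    using B(1) by (simp add: card_PiE UNIV_bit numeral_2_eq_2)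
  also have "card B = code_dim n C"
    unfolding code_dim_def using W.dim_basis[OF B] by simp
  finally show ?thesis .
qed

text \<open>The additive character \<open>(- 1) ^ (c $ i)\<close>, turning sums of codewords into
  products of signs.\<close>

definition coord_sign :: "nat \<Rightarrow> bit Matrix.vec \<Rightarrow> real" where
  "coord_sign i c = (if c $ i = 0 then 1 else - 1)"

lemma prod_coord_sign:
  assumes "finite W"
  shows "(\<Prod>i\<in>W. coord_sign i c) = (if (\<Sum>i\<in>W. c $ i) = 0 then 1 else - 1)"
  using assms
proof (induction W rule: finite_induct)
  case (insert i W)
  then show ?case
    by (cases "c $ i"; cases "\<Sum>i\<in>W. c $ i") (simp_all add: coord_sign_def)
qed simp

lemma coord_sign_add:
  assumes "i < dim_vec d"
  shows "coord_sign i (c + d) = coord_sign i c * coord_sign i d"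
  using assms by (cases "c $ i"; cases "d $ i") (simp_all add: coord_sign_def)

text \<open>
  A parity check on \<open>W\<close> that some codeword violates is violated by exactly half of the code.
\<close>

lemma indep_signs_linear_code:
  assumes C: "VectorSpace.subspace class_ring C (module_vec TYPE(bit) n)"
    and dual: "\<And>W. W \<subseteq> {..<n} \<Longrightarrow> W \<noteq> {} \<Longrightarrow> card W \<le> T \<Longrightarrow> \<exists>c\<in>C. (\<Sum>i\<in>W. c $ i) = 1"
  shows "indep_signs n T C coord_sign"
  unfolding indep_signs_def
proof (intro conjI allI impI ballI)
  have sub: "C \<subseteq> carrier_vec n"
    and add: "\<And>c d. c \<in> C \<Longrightarrow> d \<in> C \<Longrightarrow> c + d \<in> C"
    and zero: "0\<^sub>v n \<in> C"
    using C by (auto simp: VectorSpace.subspace_def submodule_def module_vec_simps)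
  show fin: "finite C"
    using sub finite_carrier_vec_bit finite_subset by blast
  show "C \<noteq> {}"
    using zero by blast
  show "coord_sign i c \<in> {- 1, 1}" for i c
    by (simp add: coord_sign_def)
  fix W assume W: "W \<subseteq> {..<n}" "W \<noteq> {}" "card W \<le> T"
  have finW: "finite W"
    using W(1) finite_subset by blast
  obtain d where d: "d \<in> C" "(\<Sum>i\<in>W. d $ i) = 1"
    using dual[OF W] by blast
  have dn: "d \<in> carrier_vec n"
    using d(1) sub by blast
  have inj: "inj_on (\<lambda>c. c + d) C"
  proof (rule inj_onI)
    fix x y assume xy: "x \<in> C" "y \<in> C" "x + d = y + d"
    then have dim: "dim_vec x = n" "dim_vec y = n"
      using sub by auto
    have "x $ i = y $ i" if "i < n" for i
    proof -
      have "(x + d) $ i = (y + d) $ i"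
        by (simp only: xy(3))
      then have "x $ i + d $ i = y $ i + d $ i"
        using that dn by (simp only: index_add_vec carrier_vecD)
      then show ?thesis
        by (simp only: add_right_cancel)
    qed
    with dim show "x = y"
      by (intro eq_vecI) auto
  qed
  \<comment> \<open>Translation by \<open>d\<close> permutes the code and flips every product over
    \<open>W\<close>, so the sum equals its own negative.\<close>
  have "(\<lambda>c. c + d) ` C = C"
    using fin inj add d(1) by (intro endo_inj_surj) auto
  then have "(\<Sum>c\<in>C. \<Prod>i\<in>W. coord_sign i c) = (\<Sum>c\<in>C. \<Prod>i\<in>W. coord_sign i (c + d))"
    using sum.reindex[OF inj, of "\<lambda>c. \<Prod>i\<in>W. coord_sign i c"] by simp
  also have "\<dots> = (\<Sum>c\<in>C. (\<Prod>i\<in>W. coord_sign i c) * (\<Prod>i\<in>W. coord_sign i d))"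
    unfolding prod.distrib[symmetric] using W(1) dn
    by (intro sum.cong prod.cong refl coord_sign_add) auto
  also have "\<dots> = - (\<Sum>c\<in>C. \<Prod>i\<in>W. coord_sign i c)"
    using d(2) by (simp add: prod_coord_sign[OF finW] sum_negf)
  finally show "(\<Sum>c\<in>C. \<Prod>i\<in>W. coord_sign i c) = 0"
    by simp
qed

lemma sum_coord_sign:
  assumes "c \<in> carrier_vec n"
  shows "(\<Sum>i<n. coord_sign i c) = real n - 2 * real (hamming_weight c)"
    and "hamming_weight c \<le> n"
proof -
  let ?Z = "{i. i < n \<and> c $ i = 0}" and ?W = "{i. i < n \<and> c $ i \<noteq> 0}"
  have w: "hamming_weight c = card ?W"
    using assms by (simp add: hamming_weight_def)
  have "(\<Sum>i<n. coord_sign i c) = real (card ?Z) - real (card ?W)"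
    by (simp add: coord_sign_def sum.If_cases Int_def)
  moreover have "card ?Z + card ?W = card {..<n}"
  proof -
    have "?Z \<union> ?W = {..<n}" "?Z \<inter> ?W = {}" by auto
    then show ?thesis
      by (metis (no_types, lifting) card_Un_disjoint finite_Un finite_lessThan)
  qed
  ultimately show "(\<Sum>i<n. coord_sign i c) = real n - 2 * real (hamming_weight c)"
    and "hamming_weight c \<le> n"
    by (simp_all add: w)
qed

text \<open>Group the codewords by weight. With \<open>g\<close> and \<open>J\<close> arbitrary,
  this handles mean, variance and distribution function alike.\<close>

lemma sum_weight_freq:
  assumes C: "VectorSpace.subspace class_ring C (module_vec TYPE(bit) n)" and "finite J"
  shows "(\<Sum>j\<in>J. g j * weight_freq n C j)
    = (\<Sum>c | c \<in> C \<and> hamming_weight c \<in> J. g (hamming_weight c)) / card C"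
proof -
  have "C \<subseteq> carrier_vec n"
    using C by (auto simp: VectorSpace.subspace_def submodule_def module_vec_simps)
  then have fin: "finite C"
    using finite_carrier_vec_bit finite_subset by blast
  have "(\<Sum>c | c \<in> C \<and> hamming_weight c \<in> J. g (hamming_weight c))
      = (\<Sum>j\<in>J. \<Sum>c | c \<in> {c \<in> C. hamming_weight c \<in> J} \<and> hamming_weight c = j. g (hamming_weight c))"
    using fin assms(2) by (intro sum.group[symmetric]) auto
  also have "\<dots> = (\<Sum>j\<in>J. g j * real (weight_count C j))"
  proof (intro sum.cong refl)
    fix j assume "j \<in> J"
    then have "{c. c \<in> {c \<in> C. hamming_weight c \<in> J} \<and> hamming_weight c = j} = {c \<in> C. hamming_weight c = j}"
      by auto
    then show "(\<Sum>c | c \<in> {c \<in> C. hamming_weight c \<in> J} \<and> hamming_weight c = j. g (hamming_weight c))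
        = g j * real (weight_count C j)"
      by (simp add: weight_count_def)
  qed
  finally show ?thesis
    by (simp add: weight_freq_def card_code_eq_power_dim[OF C] sum_divide_distrib)
qed

text \<open>Expanding the square, pairwise independence kills the terms off the diagonal, and those
  on it are 1.\<close>

lemma indep_signs_square_sum:
  assumes "indep_signs n 2 A e"
  shows "(\<Sum>a\<in>A. (\<Sum>i<n. e i a)\<^sup>2) = real n * card A"
proof -
  have pair: "(\<Sum>a\<in>A. e i a * e j a) = (if i = j then real (card A) else 0)" if "i < n" "j < n" for i j
  proof (cases "i = j")
    case True
    have "e i a * e i a = 1" if "a \<in> A" for a
      using assms \<open>i < n\<close> that unfolding indep_signs_def by fastforce
    then show ?thesis
      using True by simp
  next
    case False
    then have "(\<Sum>a\<in>A. \<Prod>k\<in>{i, j}. e k a) = 0"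
      using assms that unfolding indep_signs_def by (metis card_2_iff empty_not_insert insert_subset empty_subsetI lessThan_iff le_refl)
    then show ?thesis
      using False by simp
  qed
  have "(\<Sum>a\<in>A. (\<Sum>i<n. e i a)\<^sup>2) = (\<Sum>a\<in>A. \<Sum>i<n. \<Sum>j<n. e i a * e j a)"
    by (simp add: power2_eq_square sum_product)
  also have "\<dots> = (\<Sum>i<n. \<Sum>j<n. \<Sum>a\<in>A. e i a * e j a)"
    by (subst sum.swap, intro sum.cong refl, rule sum.swap)
  also have "\<dots> = (\<Sum>i<n. \<Sum>j<n. if i = j then real (card A) else 0)"
    by (intro sum.cong refl) (simp add: pair)
  finally show ?thesis
    by simp
qed

lemma indep_signs_sum:
  assumes "indep_signs n T A e" "1 \<le> T"
  shows "(\<Sum>a\<in>A. \<Sum>i<n. e i a) = 0"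
proof -
  have "(\<Sum>a\<in>A. e i a) = 0" if "i < n" for i
  proof -
    have "(\<Sum>a\<in>A. \<Prod>k\<in>{i}. e k a) = 0"
      using assms that unfolding indep_signs_def by (metis card.empty card_insert_disjoint One_nat_def empty_iff empty_not_insert finite.emptyI insert_subset empty_subsetI lessThan_iff)
    then show ?thesis by simp
  qed
  then show ?thesis
    by (subst sum.swap) simp
qed

text \<open>The weight is \<open>(n - S) / 2\<close> for the sign sum \<open>S\<close>, so mean and
  variance are \<open>n / 2\<close> and \<open>n / 4\<close>. The relation is decreasing, hence the
  upper range of weights becomes the lower range \<open>S \<le> z * sqrt n\<close>.\<close>

lemma code_cdf_eq_sign_sum:
  assumes C: "VectorSpace.subspace class_ring C (module_vec TYPE(bit) n)"
    and indep: "indep_signs n 2 C coord_sign" and n: "0 < n"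
  shows "code_cdf n C z = card {c \<in> C. (\<Sum>i<n. coord_sign i c) / sqrt n \<le> z} / card C"
proof -
  have sub: "C \<subseteq> carrier_vec n"
    using C by (auto simp: VectorSpace.subspace_def submodule_def module_vec_simps)
  have card: "0 < card C"
    using indep by (simp add: indep_signs_def card_gt_0_iff)
  define S where "S c = (\<Sum>i<n. coord_sign i c)" for c
  have wt: "real (hamming_weight c) = (real n - S c) / 2" "hamming_weight c \<le> n" if "c \<in> C" for c
    using sum_coord_sign[of c n] sub that by (auto simp: S_def)
  have all: "{c. c \<in> C \<and> hamming_weight c \<in> {0..n}} = C"
    using wt(2) by auto
  have "code_mean n C = (\<Sum>c\<in>C. (real n - S c) / 2) / card C"
    unfolding code_mean_def sum_weight_freq[OF C finite_atLeastAtMost] all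
    by (simp add: wt(1))
  also have "(\<Sum>c\<in>C. (real n - S c) / 2) = real n / 2 * card C"
    using indep_signs_sum[OF indep]
    by (simp add: S_def sum_subtractf flip: sum_divide_distrib)
  finally have mean: "code_mean n C = real n / 2"
    using card by simp
  have "code_variance n C = (\<Sum>c\<in>C. (real n / 2 - (real n - S c) / 2)\<^sup>2) / card C"
    unfolding code_variance_def sum_weight_freq[OF C finite_atLeastAtMost] all mean
    by (simp add: wt(1))
  also have "(\<Sum>c\<in>C. (real n / 2 - (real n - S c) / 2)\<^sup>2) = (\<Sum>c\<in>C. (S c)\<^sup>2) / 4"
    unfolding sum_divide_distrib by (intro sum.cong refl) (simp add: diff_divide_distrib power_divide)
  also have "(\<Sum>c\<in>C. (S c)\<^sup>2) = real n * card C"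
    unfolding S_def by (rule indep_signs_square_sum[OF indep])
  finally have var: "code_variance n C = real n / 4"
    using card by simp
  have sd: "sqrt (code_variance n C) = sqrt n / 2"
    unfolding var by (simp add: real_sqrt_divide)
  define J where "J = {j. j \<le> n \<and> real n / 2 - sqrt n / 2 * z \<le> real j}"
  have "code_cdf n C z = (\<Sum>j\<in>J. 1 * weight_freq n C j)"
    unfolding code_cdf_def mean sd J_def by simp
  also have "\<dots> = card {c. c \<in> C \<and> hamming_weight c \<in> J} / card C"
    by (subst sum_weight_freq[OF C]) (auto simp: J_def)
  also have "{c. c \<in> C \<and> hamming_weight c \<in> J} = {c \<in> C. S c / sqrt n \<le> z}"
    using n by (auto simp: J_def wt field_simps)
  finally show ?thesis
    by (simp add: S_def)
qed

lemma indep_signs_qqr_code: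
  assumes "prime p" "2 < p" "5 ^ k < p"
  shows "indep_signs (2 * p) k (qqr_code p) coord_sign"
proof (rule indep_signs_linear_code[OF qqr_code_subspace])
  fix W assume W: "W \<subseteq> {..<2 * p}" "W \<noteq> {}" "card W \<le> k"
  have "5 ^ card W \<le> (5::nat) ^ k"
    using W(3) by (intro power_increasing) simp_all
  with assms(3) have "5 ^ card W < p"
    by (rule le_less_trans[rotated])
  with assms(1,2) W(1,2) show "\<exists>c\<in>qqr_code p. (\<Sum>i\<in>W. c $ i) = 1"
    by (rule qqr_code_dual_distance)
qed

theorem theorem4p7:
  fixes z :: real
  shows "((\<lambda>p. code_cdf (2 * p) (qqr_code p) z) \<longlongrightarrow> cdf std_normal_distribution z)
           (inf at_top (principal {p::nat. prime p \<and> [p = 3] (mod 4)}))"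
proof -
  let ?F = "inf at_top (principal {p::nat. prime p \<and> [p = 3] (mod 4)})"
  have large: "\<forall>\<^sub>F p in ?F. prime p \<and> m < p" for m
    unfolding eventually_inf_principal using eventually_gt_at_top[of m] by (rule eventually_mono) simp
  have "filterlim (\<lambda>p::nat. 2 * p) at_top at_top"
    by real_asymp
  then have n: "filterlim (\<lambda>p::nat. 2 * p) at_top ?F"
    by (rule filterlim_mono) simp_all
  \<comment> \<open>For fixed \<open>k\<close>, the condition \<open>5 ^ k < p\<close> holds for all
    large \<open>p\<close>.\<close>
  have indep: "\<forall>\<^sub>F p in ?F. indep_signs (2 * p) k (qqr_code p) coord_sign" for k
    using large[of 2] large[of "5 ^ k"]
    by eventually_elim (simp add: indep_signs_qqr_code)
  have fin: "finite (qqr_code p) \<and> qqr_code p \<noteq> {}" for p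
  proof -
    have "qqr_code p \<subseteq> carrier_vec (2 * p)" "0\<^sub>v (2 * p) \<in> qqr_code p"
      using qqr_code_subspace[of p]
      by (auto simp: VectorSpace.subspace_def submodule_def module_vec_simps)
    then show ?thesis
      using finite_subset[OF _ finite_carrier_vec_bit] by blast
  qed
  have "((\<lambda>p. real (card {c \<in> qqr_code p. (\<Sum>i<2 * p. coord_sign i c) / sqrt (real (2 * p)) \<le> z})
      / real (card (qqr_code p))) \<longlongrightarrow> cdf std_normal_distribution z) ?F"
    by (rule indep_signs_central_limit[OF n fin indep])
  \<comment> \<open>Order 2 of independence fixes mean and variance, so the normalisations agree for
    large \<open>p\<close>.\<close>
  moreover have "\<forall>\<^sub>F p in ?F. card {c \<in> qqr_code p. (\<Sum>i<2 * p. coord_sign i c) / sqrt (real (2 * p)) \<le> z}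
      / card (qqr_code p) = code_cdf (2 * p) (qqr_code p) z"
    using indep[of 2] large[of 0]
  proof eventually_elim
    case (elim p)
    then have "0 < 2 * p" by simp
    with elim(1) show ?case
      by (intro code_cdf_eq_sign_sum[symmetric] qqr_code_subspace)
  qed
  ultimately show ?thesis
    by (rule Lim_transform_eventually)
qed

end
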